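(* Let $X\in\mathbb{R}^{n\times m}$ and let $k\ge1$ be an integer with $\operatorname{rank}(X)>k$ such that any $k$ columns of $X$ are linearly independent. Then $X$ is $(k-1)$-variation diminishing if and only if $X$ is $k$-sign regular.
   Context: A matrix $X\in\mathbb{R}^{n\times m}$ is $j$-sign consistent if all its $j\times j$ minors are nonnegative, or all its $j\times j$ minors are nonpositive. $X$ is $k$-sign regular if it is $j$-sign consistent for every $j\in\{1,\dots,k\}$ (the sign may depend on $j$). For a real vector $u\neq0$, $S^-(u)$ is the number of sign changes in $u$ after deleting all zero entries, and $S^-(0):=-1$. $X$ is $j$-variation bounding ($j\in\mathbb{Z}_{\ge0}$) if $S^-(Xu)\le j$ for all $u\in\mathbb{R}^m\setminus\{0\}$ with $S^-(u)\le j$. $X$ is $k$-variation diminishing if it is $j$-variation bounding for all $j\in\{0,\dots,k\}$. *)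

theory Defs
  imports "Jordan_Normal_Form.DL_Rank" "Jordan_Normal_Form.DL_Submatrix"
begin

definition sign_consistent :: "nat \<Rightarrow> real mat \<Rightarrow> bool" where
  "sign_consistent j X \<longleftrightarrow>
    (\<forall>I J. I \<subseteq> {..<dim_row X} \<and> J \<subseteq> {..<dim_col X} \<and> card I = j \<and> card J = j
       \<longrightarrow> det (submatrix X I J) \<ge> 0) \<or>
    (\<forall>I J. I \<subseteq> {..<dim_row X} \<and> J \<subseteq> {..<dim_col X} \<and> card I = j \<and> card J = j
       \<longrightarrow> det (submatrix X I J) \<le> 0)"

definition sign_regular :: "nat \<Rightarrow> real mat \<Rightarrow> bool" where
  "sign_regular k X \<longleftrightarrow> (\<forall>j\<in>{1..k}. sign_consistent j X)"

definition sign_changes :: "real list \<Rightarrow> nat" where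
  "sign_changes xs =
    (let ys = filter (\<lambda>x. x \<noteq> 0) xs
     in card {i. Suc i < length ys \<and> sgn (ys ! i) \<noteq> sgn (ys ! Suc i)})"

definition S_minus :: "real vec \<Rightarrow> int" where
  "S_minus u = (if u = 0\<^sub>v (dim_vec u) then -1 else int (sign_changes (list_of_vec u)))"

definition variation_bounding :: "nat \<Rightarrow> real mat \<Rightarrow> bool" where
  "variation_bounding j X \<longleftrightarrow>
    (\<forall>u \<in> carrier_vec (dim_col X) - {0\<^sub>v (dim_col X)}.
       S_minus u \<le> int j \<longrightarrow> S_minus (X *\<^sub>v u) \<le> int j)"

definition variation_diminishing :: "nat \<Rightarrow> real mat \<Rightarrow> bool" where
  "variation_diminishing k X \<longleftrightarrow> (\<forall>j\<in>{0..k}. variation_bounding j X)"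

text \<open>The columns with indices in \<open>J\<close> are linearly independent as a family: the library's
  notion is about sets of vectors, so injectivity excludes repeated columns.\<close>

definition lin_indpt_cols :: "real mat \<Rightarrow> nat set \<Rightarrow> bool" where
  "lin_indpt_cols X J \<longleftrightarrow> inj_on (col X) J \<and>
    \<not> LinearCombinations.module.lin_dep class_ring
        (module_vec TYPE(real) (dim_row X)) (col X ` J)"

end

theory Submission
  imports Defs
begin

text \<open>
  Signs of minors of order \<open>p\<close> decide whether \<open>p\<close> sign changes can occur, for each \<open>p \<le> k\<close> separately.
  The link between the two is Cramer's rule. If \<open>U\<close> has \<open>p\<close> columns, the
  values of \<open>z = U y\<close> on \<open>p + 1\<close> rows \<open>h\<^sub>0 < \<dots> < h\<^sub>p\<close> satisfy exactly one linear relation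
  \<open>\<Sum>r. (-1)^r z(h\<^sub>r) D\<^sub>r = 0\<close> when some \<open>D\<^sub>r\<close> is nonzero, where \<open>D\<^sub>r\<close> is the minor that
  omits row \<open>h\<^sub>r\<close> (lemmas \<open>circuit_relation\<close> and \<open>solve_circuit\<close>). Hence a strictly alternating \<open>z\<close> on
  these rows exists if two of the \<open>D\<^sub>r\<close> have opposite signs, and does not exist if all have the same
  sign and one is nonzero.

  \<^bold>\<open>Sign regularity implies variation diminution.\<close> Let \<open>u\<close> have \<open>q\<close> sign changes. It splits into
  \<open>q + 1\<close> consecutive blocks of constant sign, so \<open>X u = U w\<close>, where column \<open>b\<close> of \<open>U\<close> is the sum of
  the columns of \<open>X\<close> in block \<open>b\<close> with weights \<open>\<bar>u e\<bar>\<close>. By multilinearity the \<open>(q + 1)\<close>-minors of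
  \<open>U\<close> are nonnegative combinations of those of \<open>X\<close>; so they have one sign, and not all of them
  vanish because any \<open>q + 1 \<le> k\<close> columns of \<open>X\<close> are independent. It remains to see that \<open>U w\<close> cannot
  alternate on \<open>q + 2\<close> rows \<open>H\<close> (lemma \<open>not_alternates_if_minors_signed\<close>). The minors inside \<open>H\<close> could
  all be zero; adding small multiples of rows to neighbouring rows preserves the sign of the minors and
  the alternation, and it transports a nonzero minor step by step into \<open>H\<close>.

  \<^bold>\<open>Variation diminution implies sign regularity.\<close> Fix \<open>p \<le> k\<close>. A vector supported on \<open>p\<close> columns
  has at most \<open>p - 1\<close> sign changes, hence so has its image, and by basis exchange the minors with these
  \<open>p\<close> columns have one sign (lemma \<open>minors_same_sign\<close>). To compare different column sets, it suffices
  to replace one column \<open>j\<close> by its neighbour \<open>j + 1\<close> (lemma \<open>shift_connected\<close>). If the signs differed,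
  then the same argument for the matrices in which column \<open>j\<close> is \<open>s x\<^sub>j + t x\<^bsub>j+1\<^esub>\<close> with
  \<open>s, t \<ge> 0\<close> would force all their minors to vanish for a suitable \<open>s, t > 0\<close>. This yields a kernel
  vector \<open>a\<close> on \<open>p + 1\<close> columns, all of whose entries are nonzero and whose entries at \<open>j\<close> and \<open>j + 1\<close>
  agree in sign. Now \<open>rank X > k\<close> enters: some column \<open>x\<^sub>l\<close> is independent of these. For small
  \<open>\<delta>\<close> the vector \<open>a + \<delta> v\<close> still has at most \<open>p - 1\<close> sign changes although \<open>v\<close> ranges, up to sign,
  over all vectors on \<open>p + 1\<close> independent columns; and \<open>X (a + \<delta> v) = \<delta> X v\<close>. But the
  \<open>p + 1\<close> independent columns span a vector with \<open>p\<close> sign changes (lemma \<open>singular_merge_impossible\<close>).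
\<close>

(* The recursion equations would rewrite picks with index 0 or a successor into LEAST terms. *)
declare pick.simps [simp del]

section \<open>Increasing enumerations of index sets\<close>

text \<open>An increasing enumeration of a finite set is unique, so any explicit one identifies \<open>pick\<close>.\<close>

lemma pick_eqI:
  assumes mono: "\<And>i j. i < j \<Longrightarrow> j < p \<Longrightarrow> f i < f j"
    and img: "f ` {..<p} = I" and i: "i < p"
  shows "pick I i = (f i :: nat)"
proof -
  have le: "a < b \<longleftrightarrow> f a < f b" if "a < p" "b < p" for a b
    using mono[of a b] mono[of b a] that by (metis less_asym' linorder_neqE_nat)
  have "{a \<in> I. a < f i} = f ` {..<i}"
  proof -
    have "f a < f i \<longleftrightarrow> a < i" if "a < p" for a using le[OF that i] by simp
    then show ?thesis using i unfolding img[symmetric] by force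
  qed
  moreover have "inj_on f {..<i}"
    using le i by (intro inj_onI) (metis lessThan_iff less_trans linorder_neqE_nat nat_neq_iff)
  ultimately have "card {a \<in> I. a < f i} = i"
    by (simp add: card_image)
  moreover have "f i \<in> I" using i img by auto
  ultimately show ?thesis using pick_card_in_set by metis
qed

lemma pick_less_iff:
  assumes "i < card I" "j < card I"
  shows "pick I i < pick I j \<longleftrightarrow> i < j"
  using assms pick_mono_le by (metis less_asym' linorder_neqE_nat)

lemma bij_betw_pick:
  assumes "finite I"
  shows "bij_betw (pick I) {..<card I} I"
proof -
  have "inj_on (pick I) {..<card I}"
    by (intro inj_onI) (metis lessThan_iff linorder_neqE_nat nat_neq_iff pick_less_iff)
  moreover have "pick I ` {..<card I} \<subseteq> I"
    using pick_in_set_le by auto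
  ultimately show ?thesis
    using assms by (metis bij_betw_def card_image card_lessThan card_subset_eq)
qed

lemma pick_index_exists:
  assumes "finite I" "a \<in> I"
  obtains i where "i < card I" "pick I i = a"
  using bij_betw_pick[OF assms(1)] assms(2) that unfolding bij_betw_def by (metis imageE lessThan_iff)

lemma pick_remove:
  assumes "finite H" "card H = Suc p" "r \<le> p" "i < p"
  shows "pick (H - {pick H r}) i = pick H (if i < r then i else Suc i)"
proof (rule pick_eqI[where p = p, OF _ _ assms(4)])
  fix i j assume "i < j" "j < p"
  then show "pick H (if i < r then i else Suc i) < pick H (if j < r then j else Suc j)"
    using assms by (auto simp: pick_less_iff)
next
  have "{..<Suc p} - {r} \<subseteq> (\<lambda>i. if i < r then i else Suc i) ` {..<p}"
  proof
    fix x assume "x \<in> {..<Suc p} - {r}"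
    then show "x \<in> (\<lambda>i. if i < r then i else Suc i) ` {..<p}"
      using assms by (intro image_eqI[of _ _ "if x < r then x else x - 1"]) auto
  qed
  then have "(\<lambda>i. if i < r then i else Suc i) ` {..<p} = {..<Suc p} - {r}"
    by (auto split: if_splits)
  then have "(\<lambda>i. pick H (if i < r then i else Suc i)) ` {..<p} = pick H ` ({..<Suc p} - {r})"
    by (metis image_image)
  also have "\<dots> = pick H ` {..<Suc p} - {pick H r}"
    using bij_betw_pick[OF assms(1)] assms by (subst inj_on_image_set_diff[of _ "{..<Suc p}"]) (auto simp: bij_betw_def)
  also have "pick H ` {..<Suc p} = H"
    using bij_betw_pick[OF assms(1)] assms by (auto simp: bij_betw_def)
  finally show "(\<lambda>i. pick H (if i < r then i else Suc i)) ` {..<p} = H - {pick H r}" .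
qed

text \<open>Since \<open>a\<close> and \<open>j\<close> are neighbours, no element of \<open>J\<close> lies strictly between them. The exchange
  therefore keeps the order of the elements, and minors change in one row or column without a sign.\<close>

lemma pick_shift:
  assumes "finite J" "j \<in> J" "a \<notin> J" "a = Suc j \<or> j = Suc a" "i < card J"
  shows "pick (insert a (J - {j})) i = (if pick J i = j then a else pick J i)"
proof (rule pick_eqI[where p = "card J", OF _ _ assms(5)])
  fix x y assume "x < y" "y < card J"
  then have "pick J x < pick J y" "pick J x \<in> J" "pick J y \<in> J"
    by (auto simp: pick_less_iff pick_in_set_le)
  then show "(if pick J x = j then a else pick J x) < (if pick J y = j then a else pick J y)"
    using assms(3,4) by (auto simp: Suc_lessI less_Suc_eq) (metis Suc_lessI)+
next
  have "(\<lambda>i. if pick J i = j then a else pick J i) ` {..<card J} = (\<lambda>e. if e = j then a else e) ` (pick J ` {..<card J})"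
    unfolding image_image ..
  also have "pick J ` {..<card J} = J"
    using bij_betw_pick[OF assms(1)] by (auto simp: bij_betw_def)
  also have "(\<lambda>e. if e = j then a else e) ` J = insert a (J - {j})"
    using assms(2) by auto
  finally show "(\<lambda>i. if pick J i = j then a else pick J i) ` {..<card J} = insert a (J - {j})" .
qed

section \<open>Minors and solvability\<close>

text \<open>Matrices are functions with explicit sizes here, because rows and columns are selected, merged and
  perturbed throughout; \<open>img p U y\<close> is the product of a matrix with \<open>p\<close> columns and a vector.\<close>

definition img :: "nat \<Rightarrow> (nat \<Rightarrow> nat \<Rightarrow> real) \<Rightarrow> (nat \<Rightarrow> real) \<Rightarrow> nat \<Rightarrow> real" where
  "img p U y i = (\<Sum>b<p. U i b * y b)"

definition row_minor :: "nat \<Rightarrow> (nat \<Rightarrow> nat \<Rightarrow> real) \<Rightarrow> nat set \<Rightarrow> real" where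
  "row_minor p U I = det (mat p p (\<lambda>(i, b). U (pick I i) b))"

lemma img_lincomb: "img p U (\<lambda>b. s * x b + t * y b) i = s * img p U x i + t * img p U y i"
  unfolding img_def by (simp add: sum.distrib sum_distrib_left algebra_simps)

lemma img_diff: "img p U (\<lambda>b. x b - t * y b) i = img p U x i - t * img p U y i"
  using img_lincomb[of p U 1 x "- t" y i] by simp

lemma det_fun_zero_iff:
  fixes M :: "nat \<Rightarrow> nat \<Rightarrow> real"
  shows "det (mat p p (\<lambda>(i, b). M i b)) = 0 \<longleftrightarrow> (\<exists>y. (\<exists>b<p. y b \<noteq> 0) \<and> (\<forall>i<p. (\<Sum>b<p. M i b * y b) = 0))"
    (is "?L \<longleftrightarrow> ?R")
proof -
  let ?A = "mat p p (\<lambda>(i, b). M i b)"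
  have mv: "(?A *\<^sub>v v) $ i = (\<Sum>b<p. M i b * v $ b)" if "i < p" "v \<in> carrier_vec p" for v i
    using that by (auto simp: scalar_prod_def atLeast0LessThan intro!: sum.cong)
  have iff: "?L \<longleftrightarrow> (\<exists>v. v \<in> carrier_vec p \<and> v \<noteq> 0\<^sub>v p \<and> ?A *\<^sub>v v = 0\<^sub>v p)"
    by (rule det_0_iff_vec_prod_zero_field) simp
  show ?thesis
  proof
    assume ?L
    then obtain v where v: "v \<in> carrier_vec p" "v \<noteq> 0\<^sub>v p" "?A *\<^sub>v v = 0\<^sub>v p" using iff by blast
    from v(1,2) have "\<exists>b<p. v $ b \<noteq> 0" by (metis carrier_vecD eq_vecI index_zero_vec(1) index_zero_vec(2))
    moreover have "(\<Sum>b<p. M i b * v $ b) = 0" if "i < p" for i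
      using mv[OF that v(1)] v(3) that by simp
    ultimately show ?R by blast
  next
    assume ?R
    then obtain y b where y: "b < p" "y b \<noteq> 0" "\<And>i. i < p \<Longrightarrow> (\<Sum>b<p. M i b * y b) = 0" by blast
    have "vec p y \<noteq> 0\<^sub>v p" using y(1,2) by (metis index_vec index_zero_vec(1))
    moreover have "?A *\<^sub>v vec p y = 0\<^sub>v p"
    proof (rule eq_vecI)
      fix i assume "i < dim_vec (0\<^sub>v p :: real vec)"
      then have "i < p" by simp
      then show "(?A *\<^sub>v vec p y) $ i = 0\<^sub>v p $ i"
        using mv[of i "vec p y"] y(3)[of i] by simp
    qed simp
    ultimately show ?L using iff by (metis vec_carrier)
  qed
qed

lemma row_minor_zero_iff:
  assumes "finite I" "card I = p"
  shows "row_minor p U I = 0 \<longleftrightarrow> (\<exists>y. (\<exists>b<p. y b \<noteq> 0) \<and> (\<forall>i\<in>I. img p U y i = 0))"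
proof -
  have "I = pick I ` {..<p}" using bij_betw_pick[OF assms(1)] assms(2) by (simp add: bij_betw_def)
  then have "(\<forall>i\<in>I. img p U y i = 0) \<longleftrightarrow> (\<forall>i<p. img p U y (pick I i) = 0)" for y
    by (metis (no_types, lifting) imageE image_eqI lessThan_iff)
  then show ?thesis
    unfolding row_minor_def det_fun_zero_iff[of p "\<lambda>i b. U (pick I i) b"] by (simp add: img_def)
qed

lemma row_minor_kernel:
  assumes "finite I" "card I = p" "row_minor p U I \<noteq> 0"
    and "\<And>i. i \<in> I \<Longrightarrow> img p U y i = 0" "b < p"
  shows "y b = 0"
  using row_minor_zero_iff[OF assms(1,2), of U] assms(3-) by metis

lemma solve_rows:
  assumes "finite I" "card I = p" "row_minor p U I \<noteq> 0"
  obtains y where "\<And>i. i \<in> I \<Longrightarrow> img p U y i = z i"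
proof -
  let ?A = "mat p p (\<lambda>(i, b). U (pick I i) b)"
  have A: "?A \<in> carrier_mat p p" by simp
  from det_non_zero_imp_unit[OF A, of "()"] assms(3)
  have "?A \<in> Units (ring_mat TYPE(real) p ())" by (simp add: row_minor_def)
  then obtain B where B: "B \<in> carrier_mat p p" "?A * B = 1\<^sub>m p"
    unfolding Units_def by (auto simp: ring_mat_def)
  define v where "v = B *\<^sub>v vec p (\<lambda>i. z (pick I i))"
  have v: "v \<in> carrier_vec p" using B by (simp add: v_def)
  have "?A *\<^sub>v v = (?A * B) *\<^sub>v vec p (\<lambda>i. z (pick I i))"
    unfolding v_def by (rule assoc_mult_mat_vec[symmetric, OF A B(1) vec_carrier])
  also have "\<dots> = vec p (\<lambda>i. z (pick I i))"
    unfolding B(2) by (rule one_mult_mat_vec) simp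
  finally have eq: "?A *\<^sub>v v = vec p (\<lambda>i. z (pick I i))" .
  have "img p U (($) v) (pick I i) = z (pick I i)" if "i < p" for i
  proof -
    have "(?A *\<^sub>v v) $ i = img p U (($) v) (pick I i)"
      using that v by (auto simp: scalar_prod_def atLeast0LessThan img_def intro!: sum.cong)
    then show ?thesis using eq that by simp
  qed
  then have "img p U (($) v) i = z i" if "i \<in> I" for i
    using pick_index_exists[OF assms(1) that] assms(2) by metis
  then show ?thesis using that by blast
qed

text \<open>Expand the determinant of \<open>[U y | U]\<close>, restricted to the rows in \<open>H\<close>, along its first column;
  it vanishes because that column is a combination of the others.\<close>

lemma circuit_relation:
  assumes H: "finite H" "card H = Suc p"
  shows "(\<Sum>r\<le>p. (-1) ^ r * img p U y (pick H r) * row_minor p U (H - {pick H r})) = 0"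
proof -
  define M where "M i b = (case b of 0 \<Rightarrow> img p U y (pick H i) | Suc c \<Rightarrow> U (pick H i) c)" for i b
  let ?A = "mat (Suc p) (Suc p) (\<lambda>(i, b). M i b)"
  have A: "?A \<in> carrier_mat (Suc p) (Suc p)" by simp
  have "det ?A = 0"
    unfolding det_fun_zero_iff
  proof (intro exI conjI allI impI)
    show "(case 0 of 0 \<Rightarrow> - 1 | Suc c \<Rightarrow> y c) \<noteq> (0 :: real)" by simp
    show "(\<Sum>b<Suc p. M i b * (case b of 0 \<Rightarrow> - 1 | Suc c \<Rightarrow> y c)) = 0" for i
      by (subst sum.lessThan_Suc_shift) (simp add: M_def img_def)
  qed simp
  moreover have "cofactor ?A r 0 = (-1) ^ r * row_minor p U (H - {pick H r})" if "r < Suc p" for r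
  proof -
    have "mat_delete ?A r 0 = mat p p (\<lambda>(i, b). U (pick (H - {pick H r}) i) b)"
      unfolding mat_delete_def using that
      by (intro eq_matI) (auto simp: pick_remove[OF H] M_def)
    then show ?thesis by (simp add: cofactor_def row_minor_def)
  qed
  ultimately have "(\<Sum>r<Suc p. ?A $$ (r, 0) * ((-1) ^ r * row_minor p U (H - {pick H r}))) = 0"
    using laplace_expansion_column[OF A, of 0] by simp
  also have "(\<Sum>r<Suc p. ?A $$ (r, 0) * ((-1) ^ r * row_minor p U (H - {pick H r})))
    = (\<Sum>r\<le>p. (-1) ^ r * img p U y (pick H r) * row_minor p U (H - {pick H r}))"
    unfolding lessThan_Suc_atMost by (intro sum.cong) (auto simp: M_def)
  finally show ?thesis .
qed

text \<open>The relation determines the value at one row from the values at the other \<open>p\<close> rows. Those can be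
  prescribed if their minor is nonzero, and then the last value is the right one.\<close>

lemma solve_circuit:
  assumes H: "finite H" "card H = Suc p" and r0: "r0 \<le> p" "row_minor p U (H - {pick H r0}) \<noteq> 0"
    and rel: "(\<Sum>r\<le>p. (-1) ^ r * z (pick H r) * row_minor p U (H - {pick H r})) = 0"
  obtains y where "\<And>i. i \<in> H \<Longrightarrow> img p U y i = z i"
proof -
  let ?h = "pick H r0"
  have hH: "?h \<in> H" using r0 H by (intro pick_in_set_le) auto
  have c: "card (H - {?h}) = p" using H hH by simp
  obtain y where y: "\<And>i. i \<in> H - {?h} \<Longrightarrow> img p U y i = z i"
    using solve_rows[OF _ c r0(2), of z] H(1) by blast
  have "0 = (\<Sum>r\<le>p. (-1) ^ r * (img p U y (pick H r) - z (pick H r)) * row_minor p U (H - {pick H r}))"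
    using rel circuit_relation[OF H, of U y] by (simp add: algebra_simps sum_subtractf)
  also have "\<dots> = (\<Sum>r\<in>{r0}. (-1) ^ r * (img p U y (pick H r) - z (pick H r)) * row_minor p U (H - {pick H r}))"
  proof (rule sum.mono_neutral_right)
    show "\<forall>r\<in>{..p} - {r0}. (-1) ^ r * (img p U y (pick H r) - z (pick H r)) * row_minor p U (H - {pick H r}) = 0"
    proof
      fix r assume r: "r \<in> {..p} - {r0}"
      then have "pick H r \<in> H - {?h}"
        using H r0(1) pick_in_set_le[of r H] bij_betw_pick[OF H(1)]
        by (auto simp: bij_betw_def dest: inj_onD)
      then show "(-1) ^ r * (img p U y (pick H r) - z (pick H r)) * row_minor p U (H - {pick H r}) = 0"
        using y by simp
    qed
  qed (use r0 in auto)
  finally have "img p U y ?h = z ?h" using r0(2) by simp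
  then show ?thesis using that y by (metis DiffI singletonD)
qed

text \<open>This is the equality of row rank and column rank. A maximal set of rows on which the values of
  \<open>U y\<close> can be prescribed arbitrarily has trivial kernel, and comparing both properties by means of
  square matrices padded with zeros shows that it has exactly \<open>p\<close> elements.\<close>

lemma nonzero_minor_exists:
  assumes ker: "\<And>y. (\<And>i. i < n \<Longrightarrow> img p U y i = 0) \<Longrightarrow> (\<And>b. b < p \<Longrightarrow> y b = 0)"
  obtains I where "I \<subseteq> {..<n}" "card I = p" "row_minor p U I \<noteq> 0"
proof -
  (* Rows on which the values of an image can be prescribed arbitrarily; these are the independent sets of rows. *)
  define free where "free I \<longleftrightarrow> (\<forall>z. \<exists>y. \<forall>i\<in>I. img p U y i = z i)" for I
  let ?F = "{I. I \<subseteq> {..<n} \<and> free I}"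
  have "finite ?F" by (rule finite_subset[of _ "Pow {..<n}"]) auto
  moreover have "{} \<in> ?F" by (simp add: free_def)
  ultimately obtain I where I: "I \<in> ?F" and maxI: "\<And>K. K \<in> ?F \<Longrightarrow> I \<subseteq> K \<Longrightarrow> I = K"
    using finite_has_maximal[of ?F] by (metis (no_types, lifting) empty_iff)
  have fin: "finite I" using I finite_subset by auto
  have freeI: "\<exists>y. \<forall>i\<in>I. img p U y i = z i" for z
    using I by (simp add: free_def)
  have kerI: "y b = 0" if y: "\<And>i. i \<in> I \<Longrightarrow> img p U y i = 0" and b: "b < p" for y b
  proof (rule ccontr)
    assume "y b \<noteq> 0"
    then obtain l where l: "l < n" "img p U y l \<noteq> 0" using ker[of y b] b by auto
    have "free (insert l I)"
      unfolding free_def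
    proof
      fix z
      obtain x where x: "\<forall>i\<in>I. img p U x i = z i" using freeI by blast
      define t where "t = (img p U x l - z l) / img p U y l"
      have "img p U (\<lambda>b. x b - t * y b) i = z i" if "i \<in> insert l I" for i
        unfolding img_diff using that x y l by (auto simp: t_def)
      then show "\<exists>y. \<forall>i\<in>insert l I. img p U y i = z i"
        by (intro exI[of _ "\<lambda>b. x b - t * y b"] ballI)
    qed
    then have "l \<in> I" using maxI[of "insert l I"] I l by auto
    then show False using y l by simp
  qed
  let ?q = "card I"
  have "\<not> ?q < p"
  proof
    assume lt: "?q < p"
    (* Padding with zero rows gives a singular square matrix, so the rows I have a nontrivial kernel. *)
    define M where "M i b = (if i < ?q then U (pick I i) b else 0)" for i b
    let ?A = "mat p p (\<lambda>(i, b). M i b)"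
    have "det ?A = 0"
      by (subst laplace_expansion_row[of _ p ?q]) (use lt in \<open>auto simp: M_def\<close>)
    then obtain y b where y: "b < p" "y b \<noteq> 0" "\<And>i. i < p \<Longrightarrow> (\<Sum>b<p. M i b * y b) = 0"
      unfolding det_fun_zero_iff by blast
    have "img p U y i = 0" if i: "i \<in> I" for i
    proof -
      obtain r where "r < ?q" "pick I r = i" using pick_index_exists[OF fin i] by blast
      then show ?thesis using y(3)[of r] lt by (auto simp: M_def img_def)
    qed
    then show False using kerI[of y b] y(1,2) by simp
  qed
  moreover have "\<not> p < ?q"
  proof
    assume lt: "p < ?q"
    (* Padding with zero columns gives a linear relation w between the rows I; prescribing the values w contradicts it. *)
    define M where "M i b = (if b < p then U (pick I i) b else 0)" for i b
    let ?A = "mat ?q ?q (\<lambda>(i, b). M i b)"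
    have "det ?A = 0"
      by (subst laplace_expansion_column[of _ ?q p]) (use lt in \<open>auto simp: M_def\<close>)
    moreover have "mat ?q ?q (\<lambda>(i, b). M b i) = transpose_mat ?A" by (intro eq_matI) auto
    ultimately have "det (mat ?q ?q (\<lambda>(i, b). M b i)) = 0" by (simp add: det_transpose[of ?A ?q])
    then obtain w r where w: "r < ?q" "w r \<noteq> 0" "\<And>b. b < ?q \<Longrightarrow> (\<Sum>i<?q. M i b * w i) = 0"
      unfolding det_fun_zero_iff[of ?q "\<lambda>i b. M b i"] by blast
    obtain y where y: "\<forall>i\<in>I. img p U y i = w (card {a \<in> I. a < i})"
      using freeI[of "\<lambda>i. w (card {a \<in> I. a < i})"] by blast
    have img: "img p U y (pick I i) = w i" if "i < ?q" for i
      using y that by (simp add: pick_in_set_le card_pick_le)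
    have "(\<Sum>i<?q. w i * w i) = (\<Sum>i<?q. \<Sum>b<p. (M i b * w i) * y b)"
    proof (intro sum.cong refl)
      fix i assume "i \<in> {..<?q}"
      then have "w i = (\<Sum>b<p. M i b * y b)" using img[of i] by (simp add: img_def M_def)
      then have "w i * w i = w i * (\<Sum>b<p. M i b * y b)" by simp
      then show "w i * w i = (\<Sum>b<p. (M i b * w i) * y b)"
        by (simp add: sum_distrib_left mult_ac)
    qed
    also have "\<dots> = (\<Sum>b<p. (\<Sum>i<?q. M i b * w i) * y b)"
      by (subst sum.swap) (simp add: sum_distrib_right)
    also have "\<dots> = 0" using w(3) lt by simp
    finally have "w r * w r = 0"
      using w(1) by (subst (asm) sum_nonneg_eq_0_iff) auto
    then show False using w(2) by simp
  qed
  ultimately have "?q = p" by simp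
  moreover from this have "row_minor p U I \<noteq> 0"
    using kerI unfolding row_minor_zero_iff[OF fin \<open>?q = p\<close>] by metis
  ultimately show ?thesis using that[of I] I by simp
qed

section \<open>Alternating images and minors of one sign\<close>

text \<open>In contrast to the number of sign changes, the existence of \<open>p + 1\<close> strictly alternating
  entries mentions no zero entries at all, is visibly stable under small perturbations and has the form
  needed for the circuit relation. The factor \<open>\<sigma>\<close> is the sign of the first selected entry,
  up to a positive factor.\<close>

definition alternates :: "nat \<Rightarrow> nat \<Rightarrow> (nat \<Rightarrow> real) \<Rightarrow> bool" where
  "alternates p n z \<longleftrightarrow> (\<exists>H\<subseteq>{..<n}. card H = Suc p \<and> (\<exists>\<sigma>. \<forall>r\<le>p. 0 < \<sigma> * (-1) ^ r * z (pick H r)))"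

text \<open>Steinitz exchange for rows. The solution \<open>c\<close> of \<open>U c = e\<^sub>i\<close> on \<open>I\<close> spans the kernel of
  the rows \<open>I - {i}\<close>. It cannot vanish on all of \<open>I'\<close>, and a row of \<open>I'\<close> where it does not vanish can
  replace \<open>i\<close>.\<close>

lemma minor_exchange:
  assumes "finite I" "finite I'" "card I = p" "card I' = p"
    and nz: "row_minor p U I \<noteq> 0" "row_minor p U I' \<noteq> 0" and i: "i \<in> I - I'"
  obtains i' where "i' \<in> I' - I" "row_minor p U (insert i' (I - {i})) \<noteq> 0"
proof -
  obtain c where c: "\<And>a. a \<in> I \<Longrightarrow> img p U c a = (if a = i then 1 else 0)"
    using solve_rows[OF assms(1,3) nz(1), of "\<lambda>a. if a = i then 1 else 0"] by blast
  have "\<exists>b<p. c b \<noteq> 0"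
  proof (rule ccontr)
    assume "\<not> (\<exists>b<p. c b \<noteq> 0)"
    then have "img p U c i = 0" by (simp add: img_def)
    then show False using c i by simp
  qed
  then obtain i' where i': "i' \<in> I'" "img p U c i' \<noteq> 0"
    using row_minor_zero_iff[OF assms(2,4)] nz(2) by blast
  have i'I: "i' \<notin> I" using c[of i'] i' i by (metis DiffE)
  let ?K = "insert i' (I - {i})"
  have "row_minor p U ?K \<noteq> 0"
  proof
    have "card ?K = p" using assms i i'I card_gt_0_iff[of I] by auto
    moreover assume "row_minor p U ?K = 0"
    ultimately obtain y b where y: "b < p" "y b \<noteq> 0" "\<And>k. k \<in> ?K \<Longrightarrow> img p U y k = 0"
      using row_minor_zero_iff[of ?K p U] assms(1) by auto
    define t where "t = img p U y i"
    have "img p U (\<lambda>b. y b - t * c b) k = 0" if "k \<in> I" for k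
      unfolding img_diff t_def using that c y(3) by auto
    then have eq: "y b = t * c b" if "b < p" for b
      using row_minor_kernel[OF assms(1,3) nz(1), of "\<lambda>b. y b - t * c b" b] that by simp
    have "img p U y i' = t * img p U c i'"
      unfolding img_def sum_distrib_left by (intro sum.cong) (simp_all add: eq)
    then have "t = 0" using y(3)[of i'] i'(2) by simp
    then show False using eq[OF y(1)] y(2) by simp
  qed
  then show ?thesis using that i' i'I by blast
qed

text \<open>The positive values get the absolute total of the negative ones as weight, and vice versa.\<close>

lemma positive_balancing_weights:
  fixes d :: "'a \<Rightarrow> real"
  assumes "finite A" "r \<in> A" "d r > 0" "s \<in> A" "d s < 0"
  obtains w where "\<And>t. w t > 0" "(\<Sum>t\<in>A. w t * d t) = 0"
proof -
  define P where "P = (\<Sum>t\<in>A. max (d t) 0)"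
  define N where "N = (\<Sum>t\<in>A. max (- d t) 0)"
  have "P > 0" unfolding P_def by (rule sum_pos2[OF assms(1,2)]) (use assms in auto)
  moreover have "N > 0" unfolding N_def by (rule sum_pos2[OF assms(1,4)]) (use assms in auto)
  ultimately have pos: "P > 0" "N > 0" .
  define w where "w t = (if d t > 0 then N else if d t < 0 then P else 1)" for t
  have "(\<Sum>t\<in>A. w t * d t) = (\<Sum>t\<in>A. N * max (d t) 0 - P * max (- d t) 0)"
    by (intro sum.cong) (auto simp: w_def)
  also have "\<dots> = N * P - P * N"
    by (simp add: sum_subtractf sum_distrib_left P_def N_def)
  finally show ?thesis using that[of w] pos by (simp add: w_def)
qed

text \<open>By exchange, two nonzero minors of opposite sign can be assumed to share all rows but one. Their
  union \<open>H\<close> then has \<open>p + 1\<close> elements, and positive weights that balance the minors inside \<open>H\<close> are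
  the absolute values of an alternating vector that satisfies the circuit relation.\<close>

lemma minors_same_sign:
  assumes noalt: "\<And>y. \<not> alternates p n (img p U y)"
    and "I \<subseteq> {..<n}" "I' \<subseteq> {..<n}" "card I = p" "card I' = p"
    and "row_minor p U I > 0" "row_minor p U I' < 0"
  shows False
  using assms(2-)
proof (induction "card (I - I')" arbitrary: I I' rule: less_induct)
  case less
  have fin: "finite I" "finite I'" using less.prems finite_subset by auto
  have ne: "I \<noteq> I'" using less.prems by auto
  then obtain i where i: "i \<in> I - I'"
    using card_subset_eq[OF fin(2), of I] less.prems by auto
  then obtain i' where i': "i' \<in> I' - I" "row_minor p U (insert i' (I - {i})) \<noteq> 0"
    using minor_exchange[OF fin less.prems(3,4)] less.prems by (metis less_irrefl)
  let ?K = "insert i' (I - {i})"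
  have K: "?K \<subseteq> {..<n}" "card ?K = p"
    using less.prems i i' fin card_gt_0_iff[of I] by auto
  have "?K - I' = (I - I') - {i}" using i' by auto
  then have "card (?K - I') < card (I - I')" using i fin by (metis card_Diff1_less finite_Diff)
  then have "\<not> row_minor p U ?K > 0" using less.hyps[of ?K I'] less.prems K by blast
  then have neg: "row_minor p U ?K < 0" using i'(2) by linarith
  define H where "H = insert i' I"
  have H: "finite H" "card H = Suc p" "H \<subseteq> {..<n}"
    using fin i' less.prems by (auto simp: H_def)
  obtain r where r: "r < card H" "pick H r = i'" using pick_index_exists[of H i'] H by (auto simp: H_def)
  obtain s where s: "s < card H" "pick H s = i" using pick_index_exists[of H i] H i by (auto simp: H_def)
  define d where "d t = row_minor p U (H - {pick H t})" for t
  have "H - {i'} = I" "H - {i} = ?K" using i i' by (auto simp: H_def)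
  then have "d r > 0" "d s < 0" using r s neg less.prems by (auto simp: d_def)
  then obtain w where w: "\<And>t. w t > 0" "(\<Sum>t\<le>p. w t * d t) = 0"
    using positive_balancing_weights[of "{..p}" r d s] r s H by auto
  (* The position t of an element a of H is the number of elements of H below a. *)
  define z where "z a = (let t = card {x \<in> H. x < a} in (-1) ^ t * w t)" for a
  have z: "z (pick H t) = (-1) ^ t * w t" if "t \<le> p" for t
    using that H by (simp add: z_def card_pick_le)
  have pp: "(-1) ^ t * ((-1) ^ t * x) = x" for t and x :: real
    by (simp add: power_add[symmetric] mult.assoc[symmetric])
  have "(\<Sum>t\<le>p. (-1) ^ t * z (pick H t) * row_minor p U (H - {pick H t})) = (\<Sum>t\<le>p. w t * d t)"
    by (intro sum.cong) (auto simp: z pp d_def)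
  then obtain y where y: "\<And>a. a \<in> H \<Longrightarrow> img p U y a = z a"
    using solve_circuit[OF H(1,2), of r U z] r w(2) H \<open>d r > 0\<close> by (auto simp: d_def)
  have "alternates p n (img p U y)"
    unfolding alternates_def
  proof (intro exI[of _ H] conjI H exI[of _ 1] allI impI)
    fix t assume "t \<le> p"
    then show "0 < 1 * (-1) ^ t * img p U y (pick H t)"
      using y[of "pick H t"] H z w(1) by (simp add: pick_in_set_le pp)
  qed
  then show False using noalt by blast
qed

text \<open>Every set can be moved down to the initial segment \<open>{..<p}\<close>, one element by one place at a time.\<close>

lemma shift_connected:
  assumes step: "\<And>J j. J \<subseteq> {..<m} \<Longrightarrow> card J = p \<Longrightarrow> j \<in> J \<Longrightarrow> Suc j < m \<Longrightarrow> Suc j \<notin> J \<Longrightarrow>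
      P J \<longleftrightarrow> P (insert (Suc j) (J - {j}))"
    and "J \<subseteq> {..<m}" "card J = p" "J' \<subseteq> {..<m}" "card J' = p" "P J"
  shows "P J'"
proof -
  have base: "P J \<longleftrightarrow> P {..<p}" if "J \<subseteq> {..<m}" "card J = p" for J
    using that
  proof (induction "\<Sum>J" arbitrary: J rule: less_induct)
    case less
    have fin: "finite J" using less.prems finite_subset by auto
    show ?case
    proof (cases "J = {..<p}")
      case False
      then have "\<not> {..<p} \<subseteq> J" "\<not> J \<subseteq> {..<p}"
        using card_subset_eq[of J "{..<p}"] card_subset_eq[of "{..<p}" J] fin less.prems by auto
      then obtain x y where xy: "x < p" "x \<notin> J" "y \<in> J" "\<not> y < p" by auto
      define a where "a = (LEAST a. a \<in> J \<and> x < a)"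
      have a: "a \<in> J" "x < a" unfolding a_def
        using LeastI[of "\<lambda>a. a \<in> J \<and> x < a" y] xy by auto
      have "a - 1 \<notin> J"
      proof
        assume "a - 1 \<in> J"
        moreover from this have "x < a - 1" using a xy by (metis Suc_pred' less_Suc_eq gr_zeroI not_less_zero)
        ultimately have "a \<le> a - 1" unfolding a_def by (intro Least_le) (auto simp: a_def)
        then show False using a by simp
      qed
      then obtain j where j: "a = Suc j" "j \<notin> J" using a by (cases a) auto
      define K where "K = insert j (J - {a})"
      have K: "K \<subseteq> {..<m}" "card K = p" "j \<in> K" "Suc j < m" "Suc j \<notin> K"
        using less.prems a j fin card_gt_0_iff[of J] by (auto simp: K_def)
      have J_eq: "insert (Suc j) (K - {j}) = J" using a j by (auto simp: K_def)
      have "\<Sum>K = j + \<Sum>(J - {a})" using j fin by (simp add: K_def)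
      moreover have "\<Sum>J = a + \<Sum>(J - {a})" using a fin by (simp add: sum.remove)
      ultimately have "\<Sum>K < \<Sum>J" using j by simp
      then have "P K \<longleftrightarrow> P {..<p}" using less.hyps K by blast
      then show ?thesis using step[OF K] J_eq by simp
    qed simp
  qed
  show ?thesis using base[of J] base[of J'] assms(2-) by blast
qed

lemma det_row_sum:
  fixes M :: "nat \<Rightarrow> nat \<Rightarrow> real"
  assumes k: "k < p" and row: "\<And>b. b < p \<Longrightarrow> M k b = (\<Sum>e\<in>S. w e * N e b)"
  shows "det (mat p p (\<lambda>(i, b). M i b)) =
    (\<Sum>e\<in>S. w e * det (mat p p (\<lambda>(i, b). if i = k then N e b else M i b)))"
proof -
  let ?A = "mat p p (\<lambda>(i, b). M i b)"
  let ?B = "\<lambda>e. mat p p (\<lambda>(i, b). if i = k then N e b else M i b)"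
  have cof: "cofactor (?B e) k b = cofactor ?A k b" for e b
  proof -
    have "mat_delete (?B e) k b = mat_delete ?A k b"
      unfolding mat_delete_def using k by (intro eq_matI) auto
    then show ?thesis by (simp add: cofactor_def)
  qed
  have B: "det (?B e) = (\<Sum>b<p. N e b * cofactor ?A k b)" for e
  proof -
    have "det (?B e) = (\<Sum>b<p. ?B e $$ (k, b) * cofactor (?B e) k b)"
      by (rule laplace_expansion_row[OF _ k]) simp
    also have "\<dots> = (\<Sum>b<p. N e b * cofactor ?A k b)"
      unfolding cof using k by (intro sum.cong) auto
    finally show ?thesis .
  qed
  have "det ?A = (\<Sum>b<p. ?A $$ (k, b) * cofactor ?A k b)"
    by (rule laplace_expansion_row[OF _ k]) simp
  also have "\<dots> = (\<Sum>b<p. (\<Sum>e\<in>S. w e * N e b) * cofactor ?A k b)"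
    using k row by (intro sum.cong) auto
  also have "\<dots> = (\<Sum>b<p. \<Sum>e\<in>S. w e * (N e b * cofactor ?A k b))"
    by (simp only: sum_distrib_right mult.assoc)
  also have "\<dots> = (\<Sum>e\<in>S. w e * det (?B e))"
    unfolding B sum_distrib_left by (rule sum.swap)
  finally show ?thesis .
qed

lemma det_col_sum:
  fixes M :: "nat \<Rightarrow> nat \<Rightarrow> real"
  assumes k: "k < p" and col: "\<And>i. i < p \<Longrightarrow> M i k = (\<Sum>e\<in>S. w e * N e i)"
  shows "det (mat p p (\<lambda>(i, b). M i b)) =
    (\<Sum>e\<in>S. w e * det (mat p p (\<lambda>(i, b). if b = k then N e i else M i b)))"
proof -
  have tr: "det (mat p p (\<lambda>(i, b). F i b)) = det (mat p p (\<lambda>(i, b). F b i))" for F :: "nat \<Rightarrow> nat \<Rightarrow> real"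
  proof -
    have "mat p p (\<lambda>(i, b). F b i) = transpose_mat (mat p p (\<lambda>(i, b). F i b))"
      by (intro eq_matI) auto
    then show ?thesis by (simp add: det_transpose[of _ p])
  qed
  show ?thesis
    unfolding tr[of M] tr[of "\<lambda>i b. if b = k then N e i else M i b" for e]
    by (rule det_row_sum[OF k]) (rule col)
qed

text \<open>If \<open>I\<close> contains \<open>a\<close> but not its neighbour \<open>j\<close>, then replacing row \<open>a\<close> by row \<open>j\<close> keeps the rows
  in increasing order, so that the additional minor enters with the sign \<open>+\<close>. If \<open>I\<close> contains both, the
  additional determinant has two equal rows.\<close>

lemma row_minor_add_row:
  fixes U :: "nat \<Rightarrow> nat \<Rightarrow> real" and \<epsilon> :: real
  assumes I: "finite I" "card I = p" and aj: "a = Suc j \<or> j = Suc a"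
  defines "V \<equiv> U(a := (\<lambda>b. U a b + \<epsilon> * U j b))"
  shows "row_minor p V I = row_minor p U I +
    (if a \<in> I \<and> j \<notin> I then \<epsilon> * row_minor p U (insert j (I - {a})) else 0)"
proof (cases "a \<in> I")
  case False
  have "V (pick I i) = U (pick I i)" if "i < p" for i
    using that False I pick_in_set_le[of i I] by (auto simp: V_def)
  then have "mat p p (\<lambda>(i, b). V (pick I i) b) = mat p p (\<lambda>(i, b). U (pick I i) b)"
    by (intro eq_matI) auto
  then show ?thesis using False by (simp add: row_minor_def)
next
  case True
  then obtain k where k: "k < p" "pick I k = a" using pick_index_exists[OF I(1)] I(2) by metis
  have eqa: "pick I i = a \<longleftrightarrow> i = k" if "i < p" for i
    using bij_betw_pick[OF I(1)] that k I(2) by (auto simp: bij_betw_def dest: inj_onD)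
  let ?M2 = "\<lambda>i b. if i = k then U j b else U (pick I i) b"
  have V: "V (pick I i) b = (if i = k then U a b + \<epsilon> * U j b else U (pick I i) b)" if "i < p" for i b
    using eqa[OF that] by (simp add: V_def)
  have "det (mat p p (\<lambda>(i, b). V (pick I i) b)) = (\<Sum>e\<in>{a, j}. (if e = a then 1 else \<epsilon>) *
      det (mat p p (\<lambda>(i, b). if i = k then U e b else V (pick I i) b)))"
    using aj k(1) by (intro det_row_sum) (auto simp: V)
  moreover have "mat p p (\<lambda>(i, b). if i = k then U e b else V (pick I i) b) =
      mat p p (\<lambda>(i, b). if i = k then U e b else U (pick I i) b)" for e
    by (intro eq_matI) (auto simp: V)
  moreover have "mat p p (\<lambda>(i, b). if i = k then U a b else U (pick I i) b) = mat p p (\<lambda>(i, b). U (pick I i) b)"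
    by (intro eq_matI) (auto simp: k)
  ultimately have "row_minor p V I = row_minor p U I + \<epsilon> * det (mat p p (\<lambda>(i, b). ?M2 i b))"
    using aj by (auto simp: row_minor_def)
  moreover have "det (mat p p (\<lambda>(i, b). ?M2 i b)) = (if j \<in> I then 0 else row_minor p U (insert j (I - {a})))"
  proof (cases "j \<in> I")
    case True
    then obtain l where l: "l < p" "pick I l = j" using pick_index_exists[OF I(1)] I(2) by metis
    have lk: "l \<noteq> k" using l k aj by auto
    have "det (mat p p (\<lambda>(i, b). ?M2 i b)) = 0"
      by (rule det_identical_rows[of _ p l k]) (use l k lk in \<open>auto intro!: eq_vecI\<close>)
    then show ?thesis using True by simp
  next
    case False
    have "mat p p (\<lambda>(i, b). ?M2 i b) = mat p p (\<lambda>(i, b). U (pick (insert j (I - {a})) i) b)"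
      by (intro eq_matI) (use pick_shift[OF I(1) True False] aj I(2) eqa in auto)
    then show ?thesis using False by (simp add: row_minor_def)
  qed
  ultimately show ?thesis using True by auto
qed

text \<open>Let \<open>U y\<close> alternate on \<open>H\<close>. If some minor inside \<open>H\<close> were nonzero, then all terms of the circuit
  relation would have the same sign and one would be nonzero. In general only a minor \<open>J\<close> somewhere else
  is known to be nonzero, and row operations with small positive factors bring it into \<open>H\<close>.\<close>

lemma not_alternates_if_minors_signed:
  assumes nonneg: "\<And>I. I \<subseteq> {..<n} \<Longrightarrow> card I = p \<Longrightarrow> 0 \<le> \<tau> * row_minor p U I"
    and J: "J \<subseteq> {..<n}" "card J = p" "\<tau> * row_minor p U J \<noteq> 0"
  shows "\<not> alternates p n (img p U y)"
proof
  assume "alternates p n (img p U y)"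
  then obtain H \<sigma> where H: "H \<subseteq> {..<n}" "card H = Suc p"
    and alt: "\<And>r. r \<le> p \<Longrightarrow> 0 < \<sigma> * (-1) ^ r * img p U y (pick H r)"
    unfolding alternates_def by blast
  have finH: "finite H" using H finite_subset by auto
  (* K is reachable: after perturbing U, the minor of K is nonzero, with the signs of the minors and the alternation on H preserved. *)
  define P where "P K \<longleftrightarrow> (\<exists>V. (\<forall>I. I \<subseteq> {..<n} \<longrightarrow> card I = p \<longrightarrow> 0 \<le> \<tau> * row_minor p V I) \<and>
    0 < \<tau> * row_minor p V K \<and> (\<forall>r\<le>p. 0 < \<sigma> * (-1) ^ r * img p V y (pick H r)))" for K
  have step: "P (insert a (K - {j}))"
    if K: "K \<subseteq> {..<n}" "card K = p" "j \<in> K" "a \<notin> K" "a < n" and aj: "a = Suc j \<or> j = Suc a" and "P K"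
    for K a j
  proof -
    obtain V where V: "\<And>I. I \<subseteq> {..<n} \<Longrightarrow> card I = p \<Longrightarrow> 0 \<le> \<tau> * row_minor p V I"
      "0 < \<tau> * row_minor p V K" "\<And>r. r \<le> p \<Longrightarrow> 0 < \<sigma> * (-1) ^ r * img p V y (pick H r)"
      using \<open>P K\<close> unfolding P_def by blast
    let ?za = "img p V y a" and ?zj = "img p V y j"
    (* The new entry at a keeps its sign, unless it was zero, in which case a does not belong to H. *)
    define \<epsilon> where "\<epsilon> = (if ?za = 0 then 1 else \<bar>?za\<bar> / (1 + \<bar>?zj\<bar>))"
    have pos: "\<epsilon> > 0" by (auto simp: \<epsilon>_def intro!: divide_pos_pos)
    have small: "\<epsilon> * \<bar>?zj\<bar> < \<bar>?za\<bar>" if "?za \<noteq> 0"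
      using that by (simp add: \<epsilon>_def field_simps)
    define W where "W = V(a := (\<lambda>b. V a b + \<epsilon> * V j b))"
    have minor: "row_minor p W I = row_minor p V I +
      (if a \<in> I \<and> j \<notin> I then \<epsilon> * row_minor p V (insert j (I - {a})) else 0)"
      if "I \<subseteq> {..<n}" "card I = p" for I
      unfolding W_def using that aj finite_subset[of I "{..<n}"] by (intro row_minor_add_row) auto
    have "0 \<le> \<tau> * row_minor p W I" if I: "I \<subseteq> {..<n}" "card I = p" for I
    proof -
      have "insert j (I - {a}) \<subseteq> {..<n}" "a \<in> I \<Longrightarrow> j \<notin> I \<Longrightarrow> card (insert j (I - {a})) = p"
        using I K card_gt_0_iff[of I] finite_subset[of I "{..<n}"] by auto
      then have "0 \<le> \<epsilon> * (\<tau> * row_minor p V (insert j (I - {a})))" if "a \<in> I" "j \<notin> I"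
        using V(1) pos that by simp
      then show ?thesis using V(1)[OF I] by (auto simp: minor[OF I] algebra_simps)
    qed
    moreover have "0 < \<tau> * row_minor p W (insert a (K - {j}))"
    proof -
      have K': "insert a (K - {j}) \<subseteq> {..<n}" "card (insert a (K - {j})) = p"
        using K card_gt_0_iff[of K] finite_subset[of K "{..<n}"] by auto
      moreover have "insert j (insert a (K - {j}) - {a}) = K" using K by auto
      ultimately have "row_minor p W (insert a (K - {j})) = row_minor p V (insert a (K - {j})) + \<epsilon> * row_minor p V K"
        using K aj by (subst minor) auto
      then have "\<tau> * row_minor p W (insert a (K - {j})) =
          \<tau> * row_minor p V (insert a (K - {j})) + \<epsilon> * (\<tau> * row_minor p V K)"
        by (simp add: algebra_simps)
      then show ?thesis using V(1)[OF K'] V(2) pos by (simp add: add_nonneg_pos)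
    qed
    moreover have "0 < \<sigma> * (-1) ^ r * img p W y (pick H r)" if r: "r \<le> p" for r
    proof (cases "pick H r = a")
      case False
      then show ?thesis using V(3)[OF r] by (simp add: img_def W_def)
    next
      case True
      let ?s = "\<sigma> * (-1) ^ r"
      have img: "img p W y a = ?za + \<epsilon> * ?zj"
        by (simp add: img_def W_def sum.distrib sum_distrib_left algebra_simps)
      have za: "0 < ?s * ?za" using V(3)[OF r] True by simp
      then have "?za \<noteq> 0" "?s \<noteq> 0" by auto
      then have "\<bar>?s\<bar> * (\<epsilon> * \<bar>?zj\<bar>) < \<bar>?s\<bar> * \<bar>?za\<bar>" using small by (intro mult_strict_left_mono) auto
      also have "\<dots> = ?s * ?za" using za by (simp add: abs_mult[symmetric])
      finally have "\<bar>?s * (\<epsilon> * ?zj)\<bar> < ?s * ?za" using pos by (simp add: abs_mult)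
      then have "0 < ?s * ?za + ?s * (\<epsilon> * ?zj)" by linarith
      then show ?thesis unfolding True img by (simp add: algebra_simps)
    qed
    ultimately show ?thesis unfolding P_def by blast
  qed
  let ?T = "H - {pick H 0}"
  have p0: "pick H 0 \<in> H" using H by (intro pick_in_set_le) auto
  have T: "?T \<subseteq> {..<n}" "card ?T = p" using H p0 finH by auto
  have "P J" unfolding P_def using nonneg alt J by (metis order_le_less)
  moreover have "P K \<longleftrightarrow> P (insert (Suc j) (K - {j}))"
    if K: "K \<subseteq> {..<n}" "card K = p" "j \<in> K" "Suc j < n" "Suc j \<notin> K" for K j
  proof
    show "P K \<Longrightarrow> P (insert (Suc j) (K - {j}))" using step[of K j "Suc j"] K by auto
    assume P': "P (insert (Suc j) (K - {j}))"
    have K': "insert (Suc j) (K - {j}) \<subseteq> {..<n}" "card (insert (Suc j) (K - {j})) = p"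
      using K card_gt_0_iff[of K] finite_subset[of K "{..<n}"] by auto
    have "P (insert j (insert (Suc j) (K - {j}) - {Suc j}))"
      using step[of "insert (Suc j) (K - {j})" "Suc j" j, OF K' _ _ _ _ P'] K by auto
    moreover have "insert j (insert (Suc j) (K - {j}) - {Suc j}) = K" using K by auto
    ultimately show "P K" by simp
  qed
  ultimately have "P ?T"
    using shift_connected[where P = P and m = n and p = p and J = J and J' = ?T] J T by blast
  then obtain V where V: "\<And>I. I \<subseteq> {..<n} \<Longrightarrow> card I = p \<Longrightarrow> 0 \<le> \<tau> * row_minor p V I"
    "0 < \<tau> * row_minor p V ?T" "\<And>r. r \<le> p \<Longrightarrow> 0 < \<sigma> * (-1) ^ r * img p V y (pick H r)"
    unfolding P_def by blast
  let ?f = "\<lambda>r. \<sigma> * (-1) ^ r * img p V y (pick H r) * (\<tau> * row_minor p V (H - {pick H r}))"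
  have "0 < (\<Sum>r\<le>p. ?f r)"
  proof (rule sum_pos2[of _ 0])
    show "0 < ?f 0" using V(2) V(3)[of 0] by simp
    fix r assume "r \<in> {..p}"
    then have r: "r \<le> p" by simp
    then have "pick H r \<in> H" using H by (intro pick_in_set_le) auto
    then have "0 \<le> \<tau> * row_minor p V (H - {pick H r})" using H finH by (intro V(1)) auto
    then show "0 \<le> ?f r" using V(3)[OF r] by simp
  qed auto
  also have "(\<Sum>r\<le>p. ?f r) = \<tau> * \<sigma> * (\<Sum>r\<le>p. (-1) ^ r * img p V y (pick H r) * row_minor p V (H - {pick H r}))"
    by (simp add: sum_distrib_left mult_ac)
  also have "\<dots> = 0" using circuit_relation[OF finH H(2)] by simp
  finally show False by simp
qed

section \<open>Sign changes and blocks of constant sign\<close>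

lemma alternates_scale:
  assumes "\<kappa> \<noteq> 0" "alternates p n (\<lambda>i. \<kappa> * z i)"
  shows "alternates p n z"
proof -
  obtain H \<sigma> where H: "H \<subseteq> {..<n}" "card H = Suc p" "\<And>r. r \<le> p \<Longrightarrow> 0 < \<sigma> * (-1) ^ r * (\<kappa> * z (pick H r))"
    using assms(2) unfolding alternates_def by blast
  have "0 < \<sigma> * \<kappa> * (-1) ^ r * z (pick H r)" if "r \<le> p" for r
    using H(3)[OF that] by (simp add: mult_ac)
  then show ?thesis using H(1,2) unfolding alternates_def by blast
qed

lemma alternates_cong:
  assumes "\<And>i. i < n \<Longrightarrow> z i = z' i"
  shows "alternates p n z \<longleftrightarrow> alternates p n z'"
proof -
  have "z (pick H r) = z' (pick H r)" if "H \<subseteq> {..<n}" "card H = Suc p" "r \<le> p" for H r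
    using that assms pick_in_set_le[of r H] by auto
  then show ?thesis unfolding alternates_def by (metis (no_types, lifting))
qed

text \<open>Consecutive entries of an alternating selection have opposite signs, so that they lie in different
  blocks. Hence the block number increases at each of the \<open>p\<close> steps.\<close>

lemma alternates_blocks:
  assumes alt: "alternates p n z"
    and mono: "\<And>e e'. e \<le> e' \<Longrightarrow> e' < n \<Longrightarrow> c e \<le> (c e' :: nat)"
    and same: "\<And>e e'. e < n \<Longrightarrow> e' < n \<Longrightarrow> c e = c e' \<Longrightarrow> 0 \<le> z e * z e'"
  shows "\<exists>e<n. p \<le> c e"
proof -
  obtain H \<sigma> where H: "H \<subseteq> {..<n}" "card H = Suc p" "\<And>r. r \<le> p \<Longrightarrow> 0 < \<sigma> * (-1) ^ r * z (pick H r)"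
    using alt unfolding alternates_def by blast
  have less_n: "pick H r < n" if "r \<le> p" for r
    using that H(1,2) pick_in_set_le[of r H] by auto
  have "r \<le> c (pick H r)" if "r \<le> p" for r
    using that
  proof (induction r)
    case (Suc r)
    let ?x = "pick H r" and ?y = "pick H (Suc r)"
    have "?x < ?y" using Suc.prems H(2) by (intro pick_mono_le) auto
    then have le: "c ?x \<le> c ?y" using mono less_n Suc.prems by auto
    have "0 < (\<sigma> * (-1) ^ r * z ?x) * (\<sigma> * (-1) ^ Suc r * z ?y)"
      using Suc.prems by (intro mult_pos_pos H(3)) auto
    also have "\<dots> = - ((\<sigma> * (-1) ^ r)\<^sup>2 * (z ?x * z ?y))"
      by (simp add: power2_eq_square mult_ac)
    finally have "\<not> 0 \<le> z ?x * z ?y"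
      by (metis mult_nonneg_nonneg neg_0_less_iff_less not_le zero_le_power2)
    then have "c ?x \<noteq> c ?y" using same less_n Suc.prems by auto
    then show ?case using le Suc by simp
  qed simp
  then show ?thesis using less_n by blast
qed

lemma sign_changes_snoc:
  "sign_changes (xs @ [x]) = (if x = 0 then sign_changes xs
     else let ys = filter (\<lambda>x. x \<noteq> 0) xs
       in sign_changes xs + (if ys \<noteq> [] \<and> sgn (last ys) \<noteq> sgn x then 1 else 0))"
proof (cases "x = 0")
  case False
  define ys where "ys = filter (\<lambda>x. x \<noteq> 0) xs"
  let ?C = "\<lambda>ys. {i. Suc i < length ys \<and> sgn (ys ! i) \<noteq> sgn (ys ! Suc i)}"
  have sc: "sign_changes xs = card (?C ys)" "sign_changes (xs @ [x]) = card (?C (ys @ [x]))"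
    using False by (simp_all add: sign_changes_def ys_def Let_def)
  have "?C (ys @ [x]) = ?C ys \<union> (if ys \<noteq> [] \<and> sgn (last ys) \<noteq> sgn x then {length ys - 1} else {})"
  proof -
    have "i \<in> ?C (ys @ [x]) \<longleftrightarrow> i \<in> ?C ys \<or> Suc i = length ys \<and> sgn (last ys) \<noteq> sgn x" for i
    proof (cases "Suc i = length ys")
      case True
      then have "ys \<noteq> []" "i = length ys - 1" by auto
      then show ?thesis using True by (simp add: nth_append last_conv_nth)
    next
      case False
      then show ?thesis by (auto simp: nth_append)
    qed
    then show ?thesis by (cases ys) auto
  qed
  moreover have "finite (?C ys)" by (rule finite_subset[of _ "{..<length ys}"]) auto
  moreover have "length ys - 1 \<notin> ?C ys" by auto
  ultimately have "card (?C (ys @ [x])) = card (?C ys) + (if ys \<noteq> [] \<and> sgn (last ys) \<noteq> sgn x then 1 else 0)"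
    by auto
  then show ?thesis using False by (simp add: sc ys_def[symmetric])
qed (simp add: sign_changes_def)

text \<open>The block number \<open>c\<close> counts the sign changes up to a position, where zero entries stay in the current
  block and leading zeros belong to the first block. The last conjunct gives the sign of the last nonzero
  entry; in the induction it decides whether an appended entry opens a new block.\<close>

lemma sign_blocks_list:
  assumes "\<exists>x\<in>set xs. x \<noteq> 0"
  shows "\<exists>c \<sigma>. (\<sigma> = 1 \<or> \<sigma> = -1) \<and>
    (\<forall>e e'. e \<le> e' \<longrightarrow> e' < length xs \<longrightarrow> c e \<le> c e') \<and>
    (\<forall>e<length xs. c e \<le> sign_changes xs) \<and>
    (\<forall>b\<le>sign_changes xs. \<exists>e<length xs. c e = b \<and> xs ! e \<noteq> 0) \<and>
    (\<forall>e<length xs. xs ! e = \<bar>xs ! e\<bar> * (\<sigma> * (-1) ^ c e)) \<and>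
    sgn (last (filter (\<lambda>x. x \<noteq> 0) xs)) = \<sigma> * (-1) ^ sign_changes xs"
  using assms
proof (induction xs rule: rev_induct)
  case (snoc x xs)
  let ?l = "length xs"
  show ?case
  proof (cases "\<exists>x\<in>set xs. x \<noteq> 0")
    case False
    then have nil: "filter (\<lambda>x. x \<noteq> 0) xs = []" and x: "x \<noteq> 0"
      using snoc.prems by (auto simp: filter_empty_conv)
    have "sign_changes xs = 0" using nil by (simp add: sign_changes_def)
    then have q: "sign_changes (xs @ [x]) = 0" using x nil by (simp add: sign_changes_snoc)
    have "xs ! e = 0" if "e < ?l" for e using False that by auto
    then have nth: "(xs @ [x]) ! e = (if e = ?l then x else 0)" if "e < length (xs @ [x])" for e
      using that by (auto simp: nth_append less_Suc_eq)
    show ?thesis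
      unfolding q
    proof (intro exI[of _ "\<lambda>_. 0"] exI[of _ "sgn x"] conjI allI impI)
      show "sgn x = 1 \<or> sgn x = - 1" using x by (simp add: sgn_real_def)
      show "\<exists>e<length (xs @ [x]). 0 = b \<and> (xs @ [x]) ! e \<noteq> 0" if "b \<le> 0" for b :: nat
        using that x by (intro exI[of _ ?l]) simp
      show "(xs @ [x]) ! e = \<bar>(xs @ [x]) ! e\<bar> * (sgn x * (- 1) ^ 0)" if "e < length (xs @ [x])" for e
        unfolding nth[OF that] by (simp add: sgn_real_def)
      show "sgn (last (filter (\<lambda>x. x \<noteq> 0) (xs @ [x]))) = sgn x * (- 1) ^ 0" using x by simp
    qed simp_all
  next
    case True
    let ?q = "sign_changes xs"
    obtain c \<sigma> where \<sigma>: "\<sigma> = 1 \<or> \<sigma> = -1"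
      and mono: "\<And>e e'. e \<le> e' \<Longrightarrow> e' < ?l \<Longrightarrow> c e \<le> c e'"
      and le: "\<And>e. e < ?l \<Longrightarrow> c e \<le> ?q"
      and rep: "\<And>b. b \<le> ?q \<Longrightarrow> \<exists>e<?l. c e = b \<and> xs ! e \<noteq> 0"
      and sg: "\<And>e. e < ?l \<Longrightarrow> xs ! e = \<bar>xs ! e\<bar> * (\<sigma> * (-1) ^ c e)"
      and la: "sgn (last (filter (\<lambda>x. x \<noteq> 0) xs)) = \<sigma> * (-1) ^ ?q"
      using snoc.IH[OF True] by blast
    (* Whether the entry x opens a new block. *)
    define d where "d = (if x \<noteq> 0 \<and> sgn x \<noteq> \<sigma> * (-1) ^ ?q then 1 else 0 :: nat)"
    define c' where "c' = c(?l := ?q + d)"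
    have ne: "filter (\<lambda>x. x \<noteq> 0) xs \<noteq> []" using True by (auto simp: filter_empty_conv)
    have q: "sign_changes (xs @ [x]) = ?q + d"
      using ne la by (auto simp: sign_changes_snoc d_def)
    have pm: "(-1) ^ ?q = (1::real) \<or> (-1) ^ ?q = (-1::real)" by (cases "even ?q") auto
    have sx: "sgn x = \<sigma> * (-1) ^ (?q + d)" if "x \<noteq> 0"
      using that \<sigma> pm by (auto simp: d_def sgn_real_def)
    have sx': "x = \<bar>x\<bar> * (\<sigma> * (-1) ^ (?q + d))"
      by (cases "x = 0") (simp_all add: sx[symmetric] abs_mult_sgn)
    show ?thesis
      unfolding q
    proof (intro exI[of _ c'] exI[of _ \<sigma>] conjI allI impI)
      show "\<sigma> = 1 \<or> \<sigma> = -1" by (rule \<sigma>)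
      show "c' e \<le> c' e'" if "e \<le> e'" "e' < length (xs @ [x])" for e e'
        using that mono[of e e'] le[of e] by (auto simp: c'_def less_Suc_eq trans_le_add1)
      show "c' e \<le> ?q + d" if "e < length (xs @ [x])" for e
        using that le[of e] by (auto simp: c'_def less_Suc_eq)
      show "\<exists>e<length (xs @ [x]). c' e = b \<and> (xs @ [x]) ! e \<noteq> 0" if b: "b \<le> ?q + d" for b
      proof (cases "b \<le> ?q")
        case True
        then obtain e where "e < ?l" "c e = b" "xs ! e \<noteq> 0" using rep by blast
        then show ?thesis by (intro exI[of _ e]) (auto simp: c'_def nth_append)
      next
        case False
        then have "d = 1" "b = ?q + d" using b by (auto simp: d_def split: if_splits)
        then show ?thesis by (intro exI[of _ ?l]) (auto simp: c'_def d_def split: if_splits)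
      qed
      show "(xs @ [x]) ! e = \<bar>(xs @ [x]) ! e\<bar> * (\<sigma> * (-1) ^ c' e)" if "e < length (xs @ [x])" for e
        using that sg[of e] sx' by (cases "e = ?l") (auto simp: c'_def nth_append)
      show "sgn (last (filter (\<lambda>x. x \<noteq> 0) (xs @ [x]))) = \<sigma> * (-1) ^ (?q + d)"
        using la sx by (cases "x = 0") (auto simp: d_def)
    qed
  qed
qed simp

lemma S_minus_blocks:
  assumes u: "u \<in> carrier_vec m" "u \<noteq> 0\<^sub>v m"
  obtains q c \<sigma> where "S_minus u = int q" "\<sigma> = 1 \<or> \<sigma> = -1"
    and "\<And>e e'. e \<le> e' \<Longrightarrow> e' < m \<Longrightarrow> c e \<le> c e'"
    and "\<And>e. e < m \<Longrightarrow> c e \<le> q"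
    and "\<And>b. b \<le> q \<Longrightarrow> \<exists>e<m. c e = b \<and> u $ e \<noteq> 0"
    and "\<And>e. e < m \<Longrightarrow> u $ e = \<bar>u $ e\<bar> * (\<sigma> * (-1) ^ c e)"
proof -
  let ?xs = "list_of_vec u"
  have len: "length ?xs = m" and nth: "\<And>e. e < m \<Longrightarrow> ?xs ! e = u $ e"
    using u(1) by (simp_all add: list_of_vec_index)
  have "\<exists>e<m. u $ e \<noteq> 0" using u by (metis carrier_vecD eq_vecI index_zero_vec(1) index_zero_vec(2))
  then have "\<exists>x\<in>set ?xs. x \<noteq> 0" using len nth by (metis nth_mem)
  from sign_blocks_list[OF this] obtain c \<sigma> where c: "\<sigma> = 1 \<or> \<sigma> = -1"
    "\<And>e e'. e \<le> e' \<Longrightarrow> e' < m \<Longrightarrow> c e \<le> c e'"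
    "\<And>e. e < m \<Longrightarrow> c e \<le> sign_changes ?xs"
    "\<And>b. b \<le> sign_changes ?xs \<Longrightarrow> \<exists>e<m. c e = b \<and> ?xs ! e \<noteq> 0"
    "\<And>e. e < m \<Longrightarrow> ?xs ! e = \<bar>?xs ! e\<bar> * (\<sigma> * (-1) ^ c e)"
    unfolding len by blast
  have "S_minus u = int (sign_changes ?xs)" using u by (simp add: S_minus_def)
  then show ?thesis
  proof (rule that[of "sign_changes ?xs" \<sigma> c])
    show "\<exists>e<m. c e = b \<and> u $ e \<noteq> 0" if "b \<le> sign_changes ?xs" for b
      using c(4)[OF that] nth by metis
    show "u $ e = \<bar>u $ e\<bar> * (\<sigma> * (-1) ^ c e)" if "e < m" for e
      using c(5)[OF that] unfolding nth[OF that] .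
    show "\<sigma> = 1 \<or> \<sigma> = -1" by (rule c(1))
    show "c e \<le> c e'" if "e \<le> e'" "e' < m" for e e' by (rule c(2)[OF that])
    show "c e \<le> sign_changes ?xs" if "e < m" for e by (rule c(3)[OF that])
  qed
qed

text \<open>One nonzero entry from each of the first \<open>p + 1\<close> blocks of constant sign gives an alternating
  selection, and conversely an alternating selection meets \<open>p + 1\<close> blocks. For the zero vector both
  sides are false by the convention \<open>S_minus 0 = - 1\<close>.\<close>

lemma alternates_iff_S_minus:
  assumes z: "z \<in> carrier_vec n"
  shows "alternates p n (($) z) \<longleftrightarrow> int p \<le> S_minus z"
proof (cases "z = 0\<^sub>v n")
  case True
  have "\<not> alternates p n (($) z)"
  proof
    assume "alternates p n (($) z)"
    then obtain H \<sigma> where H: "H \<subseteq> {..<n}" "card H = Suc p" "\<And>r. r \<le> p \<Longrightarrow> 0 < \<sigma> * (-1) ^ r * z $ (pick H r)"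
      unfolding alternates_def by blast
    have "pick H 0 < n" using H(1,2) pick_in_set_le[of 0 H] by auto
    then show False using H(3)[of 0] True by simp
  qed
  then show ?thesis using True by (simp add: S_minus_def)
next
  case False
  obtain q c \<sigma> where q: "S_minus z = int q" and \<sigma>: "\<sigma> = 1 \<or> \<sigma> = -1"
    and mono: "\<And>e e'. e \<le> e' \<Longrightarrow> e' < n \<Longrightarrow> c e \<le> c e'"
    and le: "\<And>e. e < n \<Longrightarrow> c e \<le> q"
    and rep: "\<And>b. b \<le> q \<Longrightarrow> \<exists>e<n. c e = b \<and> z $ e \<noteq> 0"
    and sg: "\<And>e. e < n \<Longrightarrow> z $ e = \<bar>z $ e\<bar> * (\<sigma> * (-1) ^ c e)"
    by (rule S_minus_blocks[OF z False]) (rule that)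
  have sq: "\<sigma> * (-1) ^ b * (\<sigma> * (-1) ^ b * x) = x" for b and x :: real
    using \<sigma> by (auto simp: mult.assoc)
  have sg': "\<sigma> * (-1) ^ c e * z $ e = \<bar>z $ e\<bar>" if "e < n" for e
  proof -
    have "\<sigma> * (-1) ^ c e * z $ e = \<sigma> * (-1) ^ c e * (\<bar>z $ e\<bar> * (\<sigma> * (-1) ^ c e))"
      using sg[OF that] by (rule arg_cong)
    also have "\<dots> = \<bar>z $ e\<bar>" using sq[of "c e" "\<bar>z $ e\<bar>"] by (simp only: mult.commute)
    finally show ?thesis .
  qed
  show ?thesis
  proof
    assume alt: "alternates p n (($) z)"
    have same: "0 \<le> z $ e * z $ e'" if "e < n" "e' < n" "c e = c e'" for e e'
    proof -
      let ?s = "\<sigma> * (-1) ^ c e"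
      have "(?s * z $ e) * (?s * z $ e') = ?s * (?s * (z $ e * z $ e'))" by (simp only: mult_ac)
      also have "\<dots> = z $ e * z $ e'" by (rule sq)
      finally have "z $ e * z $ e' = \<bar>z $ e\<bar> * \<bar>z $ e'\<bar>"
        unfolding sg'[OF that(1)] sg'[OF that(2), folded that(3)] by (rule sym)
      then show ?thesis by simp
    qed
    have "\<exists>e<n. p \<le> c e"
    proof (rule alternates_blocks[OF alt])
      show "c e \<le> c e'" if "e \<le> e'" "e' < n" for e e' by (rule mono[OF that])
      show "0 \<le> z $ e * z $ e'" if "e < n" "e' < n" "c e = c e'" for e e' by (rule same[OF that])
    qed
    then obtain e where "e < n" "p \<le> c e" by blast
    then have "p \<le> q" using le[of e] by linarith
    then show "int p \<le> S_minus z" using q by simp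
  next
    assume "int p \<le> S_minus z"
    then have pq: "p \<le> q" using q by simp
    define \<rho> where "\<rho> b = (SOME e. e < n \<and> c e = b \<and> z $ e \<noteq> 0)" for b
    have \<rho>: "\<rho> b < n \<and> c (\<rho> b) = b \<and> z $ \<rho> b \<noteq> 0" if "b \<le> p" for b
      unfolding \<rho>_def by (rule someI_ex) (use rep[of b] that pq in auto)
    have less: "\<rho> b < \<rho> b'" if "b < b'" "b' \<le> p" for b b'
      using \<rho>[of b] \<rho>[of b'] mono[of "\<rho> b'" "\<rho> b"] that by (cases "\<rho> b < \<rho> b'") auto
    define H where "H = \<rho> ` {..<Suc p}"
    have "inj_on \<rho> {..<Suc p}"
    proof (rule linorder_inj_onI)
      fix x y assume "x < y" "y \<in> {..<Suc p}"
      then show "\<rho> x \<noteq> \<rho> y" using less[of x y] by simp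
    qed auto
    then have "card H = Suc p" by (simp add: H_def card_image)
    moreover have "H \<subseteq> {..<n}" using \<rho> by (auto simp: H_def)
    moreover have "0 < \<sigma> * (-1) ^ r * z $ pick H r" if "r \<le> p" for r
    proof -
      have "pick H r = \<rho> r"
      proof (rule pick_eqI[OF _ H_def[symmetric]])
        show "\<rho> i < \<rho> j" if "i < j" "j < Suc p" for i j using less[of i j] that by simp
      qed (use that in simp)
      moreover have "\<sigma> * (-1) ^ r * z $ \<rho> r = \<bar>z $ \<rho> r\<bar>"
        using sg'[of "\<rho> r"] \<rho>[OF that] by simp
      ultimately show ?thesis using \<rho>[OF that] by simp
    qed
    ultimately show "alternates p n (($) z)" unfolding alternates_def by blast
  qed
qed

section \<open>Block sums of columns\<close>

definition columns :: "(nat \<Rightarrow> nat \<Rightarrow> real) \<Rightarrow> nat set \<Rightarrow> nat \<Rightarrow> nat \<Rightarrow> real" where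
  "columns X J = (\<lambda>i b. X i (pick J b))"

lemma strict_choice_image:
  fixes g :: "nat \<Rightarrow> nat"
  assumes less: "\<And>b b'. b < b' \<Longrightarrow> b' < p \<Longrightarrow> g b < g b'"
  shows "card (g ` {..<p}) = p" and "row_minor p (columns X (g ` {..<p})) I = det (mat p p (\<lambda>(i, b). X (pick I i) (g b)))"
proof -
  have "inj_on g {..<p}"
  proof (rule linorder_inj_onI)
    fix x y assume "x < y" "y \<in> {..<p}"
    then show "g x \<noteq> g y" using less[of x y] by simp
  qed auto
  then show "card (g ` {..<p}) = p" by (simp add: card_image)
  have "pick (g ` {..<p}) b = g b" if "b < p" for b
    by (rule pick_eqI[OF less refl that])
  then show "row_minor p (columns X (g ` {..<p})) I = det (mat p p (\<lambda>(i, b). X (pick I i) (g b)))"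
    unfolding row_minor_def columns_def by (intro arg_cong[where f = det] eq_matI) auto
qed

text \<open>Multilinear expansion, one column at a time: \<open>D q g\<close> has the block sums in its first \<open>q\<close> columns and
  single columns \<open>g b\<close> in the remaining ones. Each expansion has nonnegative coefficients, and the
  summand for \<open>g\<close> itself keeps the determinant away from zero.\<close>

lemma det_block_sums_sign:
  fixes p :: nat and Y :: "nat \<Rightarrow> nat \<Rightarrow> real" and B :: "nat \<Rightarrow> nat set" and wt :: "nat \<Rightarrow> real"
  defines "D \<equiv> \<lambda>q g. det (mat p p (\<lambda>(i, b). if b < q then \<Sum>e\<in>B b. wt e * Y i e else Y i (g b)))"
  assumes fin: "\<And>b. finite (B b)" and wt: "\<And>e. 0 \<le> wt e"
    and nonneg: "\<And>g. (\<And>b. b < p \<Longrightarrow> g b \<in> B b) \<Longrightarrow> 0 \<le> \<tau> * det (mat p p (\<lambda>(i, b). Y i (g b)))"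
    and g: "\<And>b. b < p \<Longrightarrow> g b \<in> B b" and q: "q \<le> p"
  shows "0 \<le> \<tau> * D q g"
    and "(\<And>b. b < p \<Longrightarrow> 0 < wt (g b)) \<Longrightarrow> 0 < \<tau> * det (mat p p (\<lambda>(i, b). Y i (g b))) \<Longrightarrow> 0 < \<tau> * D q g"
proof -
  have D0: "D 0 g = det (mat p p (\<lambda>(i, b). Y i (g b)))" for g by (simp add: D_def)
  have step: "\<tau> * D (Suc q) g = (\<Sum>e\<in>B q. wt e * (\<tau> * D q (g(q := e))))" if "q < p" for q g
  proof -
    let ?M = "\<lambda>i b. if b < Suc q then \<Sum>e\<in>B b. wt e * Y i e else Y i (g b)"
    have "D (Suc q) g = (\<Sum>e\<in>B q. wt e * det (mat p p (\<lambda>(i, b). if b = q then Y i e else ?M i b)))"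
      unfolding D_def by (rule det_col_sum[OF that]) simp
    also have "\<dots> = (\<Sum>e\<in>B q. wt e * D q (g(q := e)))"
      unfolding D_def by (intro sum.cong refl arg_cong2[where f = "(*)"] arg_cong[where f = det] eq_matI) auto
    finally show ?thesis by (simp add: sum_distrib_left mult.left_commute)
  qed
  have ge: "0 \<le> \<tau> * D q g" if "q \<le> p" "\<And>b. b < p \<Longrightarrow> g b \<in> B b" for q g
    using that
  proof (induction q arbitrary: g)
    case 0
    then show ?case unfolding D0 by (intro nonneg)
  next
    case (Suc q)
    have "0 \<le> \<tau> * D q (g(q := e))" if "e \<in> B q" for e
      using Suc.prems that by (intro Suc.IH) auto
    then show ?case using Suc.prems(1) wt by (simp add: step sum_nonneg)
  qed
  show "0 \<le> \<tau> * D q g" using ge g q by blast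
  assume wtg: "\<And>b. b < p \<Longrightarrow> 0 < wt (g b)" and pos: "0 < \<tau> * det (mat p p (\<lambda>(i, b). Y i (g b)))"
  show "0 < \<tau> * D q g" using q
  proof (induction q)
    case 0
    then show ?case using pos D0 by simp
  next
    case (Suc q)
    have "0 < (\<Sum>e\<in>B q. wt e * (\<tau> * D q (g(q := e))))"
    proof (rule sum_pos2[OF fin])
      show "g q \<in> B q" using g Suc.prems by simp
      show "0 < wt (g q) * (\<tau> * D q (g(q := g q)))" using Suc wtg by simp
      show "0 \<le> wt e * (\<tau> * D q (g(q := e)))" if "e \<in> B q" for e
        using that g Suc.prems by (intro mult_nonneg_nonneg wt ge) auto
    qed
    then show ?case using step Suc.prems by simp
  qed
qed

text \<open>The blocks are intervals, so one column chosen from each block gives columns in increasing order, and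
  the minors of the block sums are nonnegative combinations of minors of \<open>X\<close>.\<close>

lemma block_image_not_alternates:
  fixes X :: "nat \<Rightarrow> nat \<Rightarrow> real"
  assumes nonneg: "\<And>I J. I \<subseteq> {..<n} \<Longrightarrow> card I = p \<Longrightarrow> J \<subseteq> {..<m} \<Longrightarrow> card J = p \<Longrightarrow>
      0 \<le> \<tau> * row_minor p (columns X J) I"
    and nz: "\<And>J. J \<subseteq> {..<m} \<Longrightarrow> card J = p \<Longrightarrow>
      \<exists>I\<subseteq>{..<n}. card I = p \<and> \<tau> * row_minor p (columns X J) I \<noteq> 0"
    and mono: "\<And>e e'. e \<le> e' \<Longrightarrow> e' < m \<Longrightarrow> c e \<le> c e'"
    and range: "\<And>e. e < m \<Longrightarrow> c e < p"
    and wt: "\<And>e. 0 \<le> wt e" and rep: "\<And>b. b < p \<Longrightarrow> \<exists>e<m. c e = b \<and> 0 < wt e"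
  shows "\<not> alternates p n (\<lambda>i. \<Sum>e<m. X i e * (wt e * w (c e)))"
proof -
  define B where "B b = {e. e < m \<and> c e = b}" for b
  define U where "U i b = (\<Sum>e\<in>B b. wt e * X i e)" for i b
  have fin: "finite (B b)" for b by (simp add: B_def)
  have less: "g b < g b'" if g: "\<And>b. b < p \<Longrightarrow> g b \<in> B b" and b: "b < b'" "b' < p" for g b b'
  proof (rule ccontr)
    assume "\<not> g b < g b'"
    then have "c (g b') \<le> c (g b)" using mono[of "g b'" "g b"] g[of b] b by (auto simp: B_def)
    then show False using g[of b] g[of b'] b by (auto simp: B_def)
  qed
  have det_g: "0 \<le> \<tau> * det (mat p p (\<lambda>(i, b). X (pick I i) (g b)))"
    if g: "\<And>b. b < p \<Longrightarrow> g b \<in> B b" and I: "I \<subseteq> {..<n}" "card I = p" for g I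
  proof -
    have less_g: "g b < g b'" if "b < b'" "b' < p" for b b' using less[OF g that] .
    have "card (g ` {..<p}) = p" by (rule strict_choice_image(1)) (rule less_g)
    moreover have "g ` {..<p} \<subseteq> {..<m}" using g by (auto simp: B_def)
    moreover have "row_minor p (columns X (g ` {..<p})) I = det (mat p p (\<lambda>(i, b). X (pick I i) (g b)))"
      by (rule strict_choice_image(2)) (rule less_g)
    ultimately show ?thesis using nonneg[OF I, of "g ` {..<p}"] by simp
  qed
  define g where "g b = (SOME e. e < m \<and> c e = b \<and> 0 < wt e)" for b
  have gs: "g b < m \<and> c (g b) = b \<and> 0 < wt (g b)" if "b < p" for b
    unfolding g_def by (rule someI_ex) (use rep[OF that] in simp)
  then have g: "g b \<in> B b" if "b < p" for b using that by (auto simp: B_def)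
  have less_g: "g b < g b'" if "b < b'" "b' < p" for b b' using less[OF g that] .
  have "card (g ` {..<p}) = p" by (rule strict_choice_image(1)) (rule less_g)
  moreover have "g ` {..<p} \<subseteq> {..<m}" using gs by auto
  moreover have "row_minor p (columns X (g ` {..<p})) I = det (mat p p (\<lambda>(i, b). X (pick I i) (g b)))" for I
    by (rule strict_choice_image(2)) (rule less_g)
  ultimately obtain I0 where I0: "I0 \<subseteq> {..<n}" "card I0 = p"
    "\<tau> * det (mat p p (\<lambda>(i, b). X (pick I0 i) (g b))) \<noteq> 0"
    using nz[of "g ` {..<p}"] by metis
  have U_minor: "row_minor p U I =
      det (mat p p (\<lambda>(i, b). if b < p then \<Sum>e\<in>B b. wt e * X (pick I i) e else X (pick I i) (g b)))" for I
    unfolding row_minor_def U_def by (intro arg_cong[where f = det] eq_matI) auto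
  have ge: "0 \<le> \<tau> * row_minor p U I" if I: "I \<subseteq> {..<n}" "card I = p" for I
    unfolding U_minor
  proof (rule det_block_sums_sign(1))
    show "0 \<le> \<tau> * det (mat p p (\<lambda>(i, b). X (pick I i) (g b)))" if "\<And>b. b < p \<Longrightarrow> g b \<in> B b" for g
      using det_g[OF that I] .
  qed (use fin wt g in auto)
  have "0 < \<tau> * row_minor p U I0"
    unfolding U_minor
  proof (rule det_block_sums_sign(2))
    show "0 \<le> \<tau> * det (mat p p (\<lambda>(i, b). X (pick I0 i) (g b)))" if "\<And>b. b < p \<Longrightarrow> g b \<in> B b" for g
      using det_g[OF that I0(1,2)] .
    show "0 < \<tau> * det (mat p p (\<lambda>(i, b). X (pick I0 i) (g b)))"
      using det_g[OF g I0(1,2)] I0(3) by linarith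
  qed (use fin wt g gs in auto)
  then have nz0: "\<tau> * row_minor p U I0 \<noteq> 0" by (rule less_imp_neq[symmetric])
  have "\<not> alternates p n (img p U w)"
  proof (rule not_alternates_if_minors_signed[OF _ I0(1,2) nz0])
    show "0 \<le> \<tau> * row_minor p U I" if "I \<subseteq> {..<n}" "card I = p" for I by (rule ge[OF that])
  qed
  moreover have "img p U w i = (\<Sum>e<m. X i e * (wt e * w (c e)))" for i
  proof -
    have "img p U w i = (\<Sum>b<p. \<Sum>e\<in>{e\<in>{..<m}. c e = b}. X i e * (wt e * w (c e)))"
      unfolding img_def U_def B_def sum_distrib_right by (intro sum.cong) (auto simp: mult_ac)
    also have "\<dots> = (\<Sum>e<m. X i e * (wt e * w (c e)))"
      using range by (intro sum.group) auto
    finally show ?thesis .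
  qed
  then have "img p U w = (\<lambda>i. \<Sum>e<m. X i e * (wt e * w (c e)))" by (rule ext)
  ultimately show ?thesis by simp
qed

section \<open>Independent columns\<close>

text \<open>Linear independence of the columns as an indexed family; two equal columns are dependent.\<close>

definition indep :: "nat \<Rightarrow> (nat \<Rightarrow> nat \<Rightarrow> real) \<Rightarrow> nat set \<Rightarrow> bool" where
  "indep n X J \<longleftrightarrow> (\<forall>v. (\<forall>i<n. (\<Sum>e\<in>J. X i e * v e) = 0) \<longrightarrow> (\<forall>e\<in>J. v e = 0))"

lemma indepD:
  assumes "indep n X J" "\<And>i. i < n \<Longrightarrow> (\<Sum>e\<in>J. X i e * v e) = 0" "e \<in> J"
  shows "v e = 0"
  using assms unfolding indep_def by blast

lemma img_cols:
  assumes "finite J" "card J = p"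
  shows "img p (columns X J) y i = (\<Sum>e\<in>J. X i e * y (card {x\<in>J. x < e}))"
proof -
  have "(\<Sum>e\<in>J. X i e * y (card {x\<in>J. x < e})) = (\<Sum>b<p. X i (pick J b) * y (card {x\<in>J. x < pick J b}))"
    using bij_betw_pick[OF assms(1)] unfolding assms(2)
    by (rule sum.reindex_bij_betw[symmetric])
  also have "\<dots> = img p (columns X J) y i"
    unfolding img_def columns_def
  proof (rule sum.cong[OF refl])
    fix b assume "b \<in> {..<p}"
    then have "card {x\<in>J. x < pick J b} = b" using assms(2) by (intro card_pick_le) simp
    then show "X i (pick J b) * y (card {x\<in>J. x < pick J b}) = X i (pick J b) * y b" by simp
  qed
  finally show ?thesis by (rule sym)
qed

lemma indep_nonzero_minor:
  assumes J: "finite J" "card J = p" and ind: "indep n X J"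
  obtains I where "I \<subseteq> {..<n}" "card I = p" "row_minor p (columns X J) I \<noteq> 0"
proof (rule nonzero_minor_exists)
  fix y b assume y: "\<And>i. i < n \<Longrightarrow> img p (columns X J) y i = 0" and b: "b < p"
  have "pick J b \<in> J" using b J by (intro pick_in_set_le) simp
  moreover have "(\<Sum>e\<in>J. X i e * y (card {x\<in>J. x < e})) = 0" if "i < n" for i
    using y[OF that] unfolding img_cols[OF J] .
  ultimately have "y (card {x\<in>J. x < pick J b}) = 0"
    using indepD[OF ind, where v = "\<lambda>e. y (card {x\<in>J. x < e})"] by blast
  moreover have "card {x\<in>J. x < pick J b} = b" using b J by (intro card_pick_le) simp
  ultimately show "y b = 0" by simp
qed (rule that)

lemma minors_product_nonneg:
  assumes noalt: "\<And>y. \<not> alternates p n (img p U y)"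
    and "I \<subseteq> {..<n}" "card I = p" "I' \<subseteq> {..<n}" "card I' = p"
  shows "0 \<le> row_minor p U I * row_minor p U I'"
proof (rule ccontr)
  assume "\<not> ?thesis"
  then have "row_minor p U I * row_minor p U I' < 0" by simp
  then consider "row_minor p U I > 0" "row_minor p U I' < 0" | "row_minor p U I' > 0" "row_minor p U I < 0"
    unfolding mult_less_0_iff by blast
  then show False
  proof cases
    case 1
    show False by (rule minors_same_sign[OF noalt assms(2,4,3,5) 1])
  next
    case 2
    show False by (rule minors_same_sign[OF noalt assms(4,2,5,3) 2])
  qed
qed

lemma small_perturbation:
  fixes f g :: "'a \<Rightarrow> real"
  assumes "finite A" "\<And>e. e \<in> A \<Longrightarrow> 0 < f e"
  obtains \<delta> where "0 < \<delta>" "\<And>e. e \<in> A \<Longrightarrow> \<delta> * \<bar>g e\<bar> < f e"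
proof -
  have "\<exists>\<delta>>0. \<forall>e\<in>A. \<delta> * \<bar>g e\<bar> < f e"
    using assms
  proof (induction A)
    case empty
    then show ?case by (intro exI[of _ 1]) simp
  next
    case (insert a A)
    then obtain \<delta> where \<delta>: "0 < \<delta>" "\<forall>e\<in>A. \<delta> * \<bar>g e\<bar> < f e" by auto
    define \<delta>' where "\<delta>' = min \<delta> (f a / (1 + \<bar>g a\<bar>))"
    have fa: "0 < f a" using insert.prems by simp
    have pos: "0 < \<delta>'" using \<delta>(1) fa by (simp add: \<delta>'_def)
    have "\<delta>' * \<bar>g a\<bar> < \<delta>' * (1 + \<bar>g a\<bar>)" using pos by simp
    also have "\<dots> \<le> f a / (1 + \<bar>g a\<bar>) * (1 + \<bar>g a\<bar>)"
      by (intro mult_right_mono) (auto simp: \<delta>'_def)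
    also have "\<dots> = f a" by (simp add: add_pos_nonneg less_imp_neq[symmetric])
    finally have "\<delta>' * \<bar>g a\<bar> < f a" .
    moreover have "\<delta>' * \<bar>g e\<bar> < f e" if "e \<in> A" for e
    proof -
      have "\<delta>' * \<bar>g e\<bar> \<le> \<delta> * \<bar>g e\<bar>" by (intro mult_right_mono) (auto simp: \<delta>'_def)
      then show ?thesis using \<delta>(2) that by force
    qed
    ultimately show ?case using pos by blast
  qed
  then show ?thesis using that by blast
qed

section \<open>Merging neighbouring columns\<close>

text \<open>The columns are divided into \<open>card J\<close> intervals that start at the elements of \<open>J\<close>. Truncated
  subtraction adds the indices below \<open>J\<close> to the first interval.\<close>

definition cell :: "nat set \<Rightarrow> nat \<Rightarrow> nat" where
  "cell J e = card {x\<in>J. x \<le> e} - 1"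

lemma cell_mono:
  assumes "finite J" "e \<le> e'"
  shows "cell J e \<le> cell J e'"
  unfolding cell_def using assms by (intro diff_le_mono card_mono) auto

lemma cell_less:
  assumes "finite J" "J \<noteq> {}"
  shows "cell J e < card J"
proof -
  have "card {x\<in>J. x \<le> e} \<le> card J" using assms by (intro card_mono) auto
  moreover have "0 < card J" using assms by (simp add: card_gt_0_iff)
  ultimately show ?thesis by (simp add: cell_def)
qed

lemma cell_member:
  assumes "finite J" "e \<in> J"
  shows "cell J e = card {x\<in>J. x < e}"
proof -
  have "{x\<in>J. x \<le> e} = insert e {x\<in>J. x < e}" using assms by auto
  then show ?thesis using assms by (simp add: cell_def)
qed

lemma cell_pick:
  assumes "finite J" "b < card J"
  shows "cell J (pick J b) = b"
  using assms by (simp add: cell_member pick_in_set_le card_pick_le)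

lemma cell_Suc:
  assumes "Suc j \<notin> J"
  shows "cell J (Suc j) = cell J j"
proof -
  have "{x\<in>J. x \<le> Suc j} = {x\<in>J. x \<le> j}" using assms le_Suc_eq by auto
  then show ?thesis by (simp add: cell_def)
qed

text \<open>The signs of \<open>w\<close> prescribe one sign for each of the \<open>p\<close> intervals, so \<open>u\<close> has fewer than \<open>p\<close> sign
  changes.\<close>

lemma not_alternates_cells:
  assumes J: "finite J" "card J = p" "J \<noteq> {}"
    and sign: "\<And>e. e < m \<Longrightarrow> 0 \<le> u e * w (cell J e)" and w: "\<And>e. e < m \<Longrightarrow> w (cell J e) = 0 \<Longrightarrow> u e = 0"
  shows "\<not> alternates p m u"
proof
  assume alt: "alternates p m u"
  have "\<exists>e<m. p \<le> cell J e"
  proof (rule alternates_blocks[OF alt])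
    show "cell J e \<le> cell J e'" if "e \<le> e'" for e e' by (rule cell_mono[OF J(1) that])
    fix e e' assume e: "e < m" "e' < m" "cell J e = cell J e'"
    show "0 \<le> u e * u e'"
    proof (cases "w (cell J e) = 0")
      case True
      then show ?thesis using w e(1) by simp
    next
      case False
      have "0 \<le> (u e * w (cell J e)) * (u e' * w (cell J e))"
        using sign[OF e(1)] sign[OF e(2)] e(3) by simp
      also have "\<dots> = (u e * u e') * (w (cell J e))\<^sup>2" by (simp add: power2_eq_square mult_ac)
      finally show ?thesis using False by (simp add: zero_le_mult_iff)
    qed
  qed
  then show False using cell_less[OF J(1,3)] J(2) by (metis not_le)
qed

text \<open>The hypotheses of the converse direction for a single order \<open>p\<close>. The assumption \<open>extend\<close> is the
  form in which a rank greater than \<open>p\<close> is used.\<close>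

locale bounding =
  fixes n m p :: nat and X :: "nat \<Rightarrow> nat \<Rightarrow> real"
  assumes bounding: "\<And>u. \<not> alternates p m u \<Longrightarrow> \<not> alternates p n (\<lambda>i. \<Sum>e<m. X i e * u e)"
    and indep: "\<And>J. J \<subseteq> {..<m} \<Longrightarrow> card J = p \<Longrightarrow> indep n X J"
    and extend: "\<And>J. J \<subseteq> {..<m} \<Longrightarrow> card J = p \<Longrightarrow> \<exists>l<m. l \<notin> J \<and> indep n X (insert l J)"
begin

definition merge :: "nat set \<Rightarrow> nat \<Rightarrow> real \<Rightarrow> real \<Rightarrow> nat \<Rightarrow> nat \<Rightarrow> real" where
  "merge J j s t i b = (if pick J b = j then s * X i j + t * X i (Suc j) else X i (pick J b))"

text \<open>The coefficient vector on the columns of \<open>X\<close> that corresponds to \<open>y\<close> on the columns of \<open>merge J j s t\<close>.\<close>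

definition spread :: "nat set \<Rightarrow> nat \<Rightarrow> real \<Rightarrow> real \<Rightarrow> (nat \<Rightarrow> real) \<Rightarrow> nat \<Rightarrow> real" where
  "spread J j s t y e = (if e = j then s else if e = Suc j then t else if e \<in> J then 1 else 0) * y (cell J e)"

context
  fixes J j
  assumes J: "J \<subseteq> {..<m}" "card J = p" and j: "j \<in> J" "Suc j < m" "Suc j \<notin> J"
begin

lemma finJ: "finite J" using J(1) finite_subset by blast

lemma neJ: "J \<noteq> {}" using j(1) by blast

lemma img_merge: "img p (merge J j s t) y i = (\<Sum>e\<in>insert (Suc j) J. X i e * spread J j s t y e)"
proof -
  let ?f = "\<lambda>e. (if e = j then s * X i j + t * X i (Suc j) else X i e) * y (cell J e)"
  have "img p (merge J j s t) y i = (\<Sum>b<p. ?f (pick J b))"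
    unfolding img_def merge_def using J(2) by (intro sum.cong) (auto simp: cell_pick[OF finJ])
  also have "\<dots> = (\<Sum>e\<in>J. ?f e)"
    using bij_betw_pick[OF finJ] unfolding J(2) by (rule sum.reindex_bij_betw)
  also have "\<dots> = ?f j + (\<Sum>e\<in>J - {j}. ?f e)" using finJ j(1) by (rule sum.remove)
  also have "(\<Sum>e\<in>J - {j}. ?f e) = (\<Sum>e\<in>J - {j}. X i e * spread J j s t y e)"
    using j(3) by (intro sum.cong) (auto simp: spread_def)
  also have "?f j = X i j * spread J j s t y j + X i (Suc j) * spread J j s t y (Suc j)"
    by (simp add: spread_def cell_Suc[OF j(3)] algebra_simps)
  also have "X i j * spread J j s t y j + X i (Suc j) * spread J j s t y (Suc j) +
      (\<Sum>e\<in>J - {j}. X i e * spread J j s t y e) =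
      X i (Suc j) * spread J j s t y (Suc j) + (\<Sum>e\<in>J. X i e * spread J j s t y e)"
    by (simp add: sum.remove[OF finJ j(1), of "\<lambda>e. X i e * spread J j s t y e"])
  also have "\<dots> = (\<Sum>e\<in>insert (Suc j) J. X i e * spread J j s t y e)"
    using finJ j(3) by simp
  finally show ?thesis .
qed

lemma spread_support: "e \<notin> insert (Suc j) J \<Longrightarrow> spread J j s t y e = 0"
  using j(1) by (auto simp: spread_def)

text \<open>For \<open>s, t \<ge> 0\<close> the entries of the coefficient vector at \<open>j\<close> and \<open>j + 1\<close> do not have opposite signs;
  it has at most \<open>p - 1\<close> sign changes although its support may have \<open>p + 1\<close> elements.\<close>

lemma merge_not_alternates:
  assumes "0 \<le> s" "0 \<le> t"
  shows "\<not> alternates p n (img p (merge J j s t) y)"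
proof -
  have "\<not> alternates p m (spread J j s t y)"
  proof (rule not_alternates_cells[OF finJ J(2) neJ])
    show "0 \<le> spread J j s t y e * y (cell J e)" for e
      using assms by (auto simp: spread_def mult.assoc)
  qed (simp add: spread_def)
  then have "\<not> alternates p n (\<lambda>i. \<Sum>e<m. X i e * spread J j s t y e)" by (rule bounding)
  moreover have "(\<Sum>e<m. X i e * spread J j s t y e) = img p (merge J j s t) y i" for i
    unfolding img_merge using J(1) j(2) by (intro sum.mono_neutral_right) (auto simp: spread_support)
  ultimately show ?thesis by simp
qed

lemma merge_minor:
  assumes "card I = p"
  shows "row_minor p (merge J j s t) I =
    s * row_minor p (columns X J) I + t * row_minor p (columns X (insert (Suc j) (J - {j}))) I"
proof -
  obtain k where k: "k < p" "pick J k = j" using pick_index_exists[OF finJ j(1)] J(2) by metis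
  have eqj: "pick J b = j \<longleftrightarrow> b = k" if "b < p" for b
    using bij_betw_pick[OF finJ] that k J(2) by (auto simp: bij_betw_def dest: inj_onD)
  let ?M = "\<lambda>i b. if b = k then s * X (pick I i) j + t * X (pick I i) (Suc j) else X (pick I i) (pick J b)"
  have "row_minor p (merge J j s t) I = det (mat p p (\<lambda>(i, b). ?M i b))"
    unfolding row_minor_def merge_def by (intro arg_cong[where f = det] eq_matI) (auto simp: eqj)
  also have "\<dots> = (\<Sum>e\<in>{j, Suc j}. (if e = j then s else t) *
      det (mat p p (\<lambda>(i, b). if b = k then X (pick I i) e else ?M i b)))"
    by (rule det_col_sum[OF k(1)]) simp
  also have "\<dots> = s * det (mat p p (\<lambda>(i, b). if b = k then X (pick I i) j else ?M i b)) +
      t * det (mat p p (\<lambda>(i, b). if b = k then X (pick I i) (Suc j) else ?M i b))"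
    by simp
  also have "mat p p (\<lambda>(i, b). if b = k then X (pick I i) j else ?M i b) =
      mat p p (\<lambda>(i, b). columns X J (pick I i) b)"
    by (intro eq_matI) (auto simp: columns_def k)
  also have "mat p p (\<lambda>(i, b). if b = k then X (pick I i) (Suc j) else ?M i b) =
      mat p p (\<lambda>(i, b). columns X (insert (Suc j) (J - {j})) (pick I i) b)"
    using pick_shift[OF finJ j(1,3)] J(2) by (intro eq_matI) (auto simp: columns_def eqj)
  finally show ?thesis unfolding row_minor_def .
qed

text \<open>A kernel vector \<open>a\<close> on the columns \<open>J \<union> {j + 1}\<close> with entries of equal sign at \<open>j\<close> and \<open>j + 1\<close>
  leaves room for one more column \<open>l\<close>: the perturbed vector \<open>u = a + \<delta> v\<close> has the signs of \<open>a\<close> on \<open>J\<close>,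
  and the entry at \<open>l\<close> can be given the sign of the interval that contains \<open>l\<close>. So \<open>u\<close> has at
  most \<open>p - 1\<close> sign changes, while its image \<open>\<delta> X v\<close> is an arbitrary combination, up to a factor, of
  \<open>p + 1\<close> independent columns and can alternate \<open>p\<close> times.\<close>

lemma singular_merge_impossible:
  assumes st: "0 < s" "0 < t" and ker: "\<And>i. i < n \<Longrightarrow> img p (merge J j s t) y i = 0" and y: "b < p" "y b \<noteq> 0"
  shows False
proof -
  let ?a = "spread J j s t y"
  have kerK: "(\<Sum>e\<in>K. X i e * ?a e) = 0" if "i < n" "K \<subseteq> {..<m}" "\<And>e. e \<in> insert (Suc j) J - K \<Longrightarrow> ?a e = 0" for i K
  proof -
    have "(\<Sum>e\<in>K. X i e * ?a e) = (\<Sum>e\<in>K \<union> insert (Suc j) J. X i e * ?a e)"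
      using that finJ finite_subset[of K "{..<m}"] by (intro sum.mono_neutral_left) auto
    also have "\<dots> = (\<Sum>e\<in>insert (Suc j) J. X i e * ?a e)"
      using that finJ finite_subset[of K "{..<m}"] spread_support by (intro sum.mono_neutral_right) auto
    finally show ?thesis using ker[OF that(1)] by (simp only: img_merge)
  qed
  (* All entries of the kernel vector on J and j + 1 are nonzero, since any p of these p + 1 columns are independent. *)
  have yj: "y (cell J j) \<noteq> 0"
  proof
    assume "y (cell J j) = 0"
    then have z: "?a e = 0" if "e \<in> insert (Suc j) J - J" for e
      using that by (auto simp: spread_def cell_Suc[OF j(3)])
    have s0: "(\<Sum>e\<in>J. X i e * ?a e) = 0" if "i < n" for i
      by (rule kerK[OF that J(1)]) (rule z)
    have pJ: "pick J b \<in> J" using y(1) J(2) by (intro pick_in_set_le) simp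
    have "?a (pick J b) = 0" by (rule indepD[where v = ?a, OF indep[OF J] _ pJ]) (rule s0)
    moreover have "pick J b \<noteq> Suc j" using pJ j(3) by metis
    ultimately show False
      using y st pJ J(2) by (simp add: spread_def cell_pick[OF finJ] split: if_splits)
  qed
  have ya: "y (cell J e) \<noteq> 0" if e: "e \<in> J" for e
  proof
    assume y0: "y (cell J e) = 0"
    then have "e \<noteq> j" using yj by auto
    let ?K = "insert (Suc j) (J - {e})"
    have K: "?K \<subseteq> {..<m}" "card ?K = p" using J j e finJ card_gt_0_iff[of J] by auto
    have z: "?a x = 0" if "x \<in> insert (Suc j) J - ?K" for x using that y0 by (auto simp: spread_def)
    have s0: "(\<Sum>x\<in>?K. X i x * ?a x) = 0" if "i < n" for i
      by (rule kerK[OF that K(1)]) (rule z)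
    have "?a (Suc j) = 0" by (rule indepD[where v = ?a, OF indep[OF K] _ insertI1]) (rule s0)
    then show False using yj st by (simp add: spread_def cell_Suc[OF j(3)])
  qed
  obtain l where l: "l < m" "l \<notin> J" "indep n X (insert l J)" using extend[OF J] by blast
  let ?K = "insert l J"
  have K: "?K \<subseteq> {..<m}" "finite ?K" "card ?K = Suc p" using J l finJ by auto
  have lj: "l \<noteq> Suc j"
  proof
    assume "l = Suc j"
    then have s0: "(\<Sum>x\<in>?K. X i x * ?a x) = 0" if "i < n" for i
      using that by (intro kerK[OF _ K(1)]) auto
    have "?a l = 0" by (rule indepD[where v = ?a, OF l(3) _ insertI1]) (rule s0)
    then show False using yj st \<open>l = Suc j\<close> by (simp add: spread_def cell_Suc[OF j(3)])
  qed
  obtain H where H: "H \<subseteq> {..<n}" "card H = Suc p" "row_minor (Suc p) (columns X ?K) H \<noteq> 0"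
    using indep_nonzero_minor[OF K(2,3) l(3)] by blast
  have finH: "finite H" using H(1) finite_subset by blast
  (* A combination of the independent columns insert l J whose image alternates on H. *)
  obtain x where x: "\<And>i. i \<in> H \<Longrightarrow> img (Suc p) (columns X ?K) x i = (-1) ^ card {a\<in>H. a < i}"
    using solve_rows[OF finH H(2,3), of "\<lambda>i. (-1) ^ card {a\<in>H. a < i}"] by blast
  define v where "v e = (if e \<in> ?K then x (card {a\<in>?K. a < e}) else 0)" for e
  have Xv: "(\<Sum>e<m. X i e * v e) = img (Suc p) (columns X ?K) x i" for i
  proof -
    have "(\<Sum>e<m. X i e * v e) = (\<Sum>e\<in>?K. X i e * v e)"
      using K(1) by (intro sum.mono_neutral_right) (auto simp: v_def)
    also have "\<dots> = img (Suc p) (columns X ?K) x i"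
      unfolding img_cols[OF K(2,3)] by (intro sum.cong) (simp_all add: v_def)
    finally show ?thesis .
  qed
  have alt: "alternates p n (\<lambda>i. \<Sum>e<m. X i e * v e)"
    unfolding alternates_def
  proof (intro exI[of _ H] conjI H exI[of _ 1] allI impI)
    fix r assume "r \<le> p"
    then have r: "r < card H" using H(2) by simp
    then show "0 < 1 * (- 1) ^ r * (\<Sum>e<m. X (pick H r) e * v e)"
      unfolding Xv x[OF pick_in_set_le[OF r]] by (simp add: card_pick_le)
  qed
  obtain \<delta>0 where \<delta>0: "0 < \<delta>0" "\<And>e. e \<in> J \<Longrightarrow> \<delta>0 * \<bar>v e\<bar> < \<bar>?a e\<bar>"
  proof (rule small_perturbation[OF finJ])
    show "0 < \<bar>?a e\<bar>" if "e \<in> J" for e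
      using ya[OF that] that st j(3) by (auto simp: spread_def)
  qed (rule that)
  (* The sign of \<delta> is chosen so that the entry at l agrees with the interval that contains l. *)
  define \<delta> where "\<delta> = (if 0 \<le> v l * y (cell J l) then \<delta>0 else - \<delta>0)"
  have "0 \<le> \<delta> * (v l * y (cell J l))"
    using \<delta>0(1) by (cases "0 \<le> v l * y (cell J l)") (simp_all add: \<delta>_def mult_le_0_iff[of \<delta>0])
  then have \<delta>: "\<delta> \<noteq> 0" "\<bar>\<delta>\<bar> = \<delta>0" "0 \<le> \<delta> * v l * y (cell J l)"
    using \<delta>0(1) by (auto simp: \<delta>_def mult.assoc)
  define u where "u e = ?a e + \<delta> * v e" for e
  have "\<not> alternates p m u"
  proof (rule not_alternates_cells[OF finJ J(2) neJ])
    fix e assume "e < m"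
    have "cell J e < p" using cell_less[OF finJ neJ] J(2) by simp
    then have "pick J (cell J e) \<in> J" "cell J (pick J (cell J e)) = cell J e"
      using pick_in_set_le[of "cell J e" J] cell_pick[OF finJ] J(2) by auto
    then show "u e = 0" if "y (cell J e) = 0" using ya that by metis
    show "0 \<le> u e * y (cell J e)"
    proof (cases "e \<in> J")
      case True
      then have pos: "0 \<le> ?a e * y (cell J e)" using st j(3) by (auto simp: spread_def mult.assoc)
      have "\<bar>\<delta> * v e\<bar> \<le> \<bar>?a e\<bar>" using \<delta>0(2)[OF True] \<delta>(2) by (simp add: abs_mult)
      then have "\<bar>\<delta> * v e\<bar> * \<bar>y (cell J e)\<bar> \<le> \<bar>?a e\<bar> * \<bar>y (cell J e)\<bar>" by (rule mult_right_mono) simp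
      also have "\<dots> = ?a e * y (cell J e)" using pos by (simp only: abs_mult[symmetric] abs_of_nonneg)
      finally have "\<bar>\<delta> * v e * y (cell J e)\<bar> \<le> ?a e * y (cell J e)" by (simp only: abs_mult)
      then have "0 \<le> ?a e * y (cell J e) + \<delta> * v e * y (cell J e)" by linarith
      then show ?thesis unfolding u_def by (simp only: distrib_right)
    next
      case False
      consider "e = Suc j" | "e = l" "e \<noteq> Suc j" | "e \<notin> ?K" "e \<noteq> Suc j" using False by blast
      then show ?thesis
      proof cases
        case 1
        then show ?thesis using st lj j(3) by (auto simp: u_def v_def spread_def mult.assoc)
      next
        case 2
        then show ?thesis using \<delta>(3) l(2) spread_support[of l s t y] lj by (simp add: u_def)
      next
        case 3
        then show ?thesis using spread_support[of e s t y] by (simp add: u_def v_def)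
      qed
    qed
  qed
  then have "\<not> alternates p n (\<lambda>i. \<Sum>e<m. X i e * u e)" by (rule bounding)
  moreover have "(\<Sum>e<m. X i e * u e) = \<delta> * (\<Sum>e<m. X i e * v e)" if "i < n" for i
  proof -
    have "(\<Sum>e<m. X i e * ?a e) = 0" using kerK[OF that, of "{..<m}"] J(1) j(2) by auto
    then show ?thesis
      by (simp add: u_def distrib_left sum.distrib sum_distrib_left mult.left_commute)
  qed
  ultimately have "\<not> alternates p n (\<lambda>i. \<delta> * (\<Sum>e<m. X i e * v e))"
    using alternates_cong[of n "\<lambda>i. \<Sum>e<m. X i e * u e" "\<lambda>i. \<delta> * (\<Sum>e<m. X i e * v e)" p] by blast
  then show False
    using alternates_scale[of "1 / \<delta>" p n "\<lambda>i. \<delta> * (\<Sum>e<m. X i e * v e)"] alt \<delta>(1) by simp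
qed

end

end

context bounding
begin

text \<open>Suppose the minors for \<open>J\<close> and for its neighbour have opposite signs \<open>\<alpha> \<ge> 0\<close> and \<open>- \<beta> \<le> 0\<close>. The minors of
  the merged matrices are \<open>s \<alpha> - t \<beta>\<close>, and for each \<open>s, t \<ge> 0\<close> they have one sign. This is only
  possible if the pairs \<open>(\<alpha> I, \<beta> I)\<close> are all proportional, and then one choice of \<open>s, t > 0\<close> makes all
  merged minors zero.\<close>

lemma adjacent_columns_sign:
  assumes J: "J \<subseteq> {..<m}" "card J = p" and j: "j \<in> J" "Suc j < m" "Suc j \<notin> J"
    and I0: "I0 \<subseteq> {..<n}" "card I0 = p" "0 < \<tau> * row_minor p (columns X J) I0"
    and le: "\<And>I. I \<subseteq> {..<n} \<Longrightarrow> card I = p \<Longrightarrow> \<tau> * row_minor p (columns X (insert (Suc j) (J - {j}))) I \<le> 0"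
  shows False
proof -
  let ?J' = "insert (Suc j) (J - {j})"
  define \<alpha> where "\<alpha> I = \<tau> * row_minor p (columns X J) I" for I
  define \<beta> where "\<beta> I = - (\<tau> * row_minor p (columns X ?J') I)" for I
  have finJ: "finite J" using J(1) finite_subset by blast
  have J': "?J' \<subseteq> {..<m}" "card ?J' = p" using J j finJ card_gt_0_iff[of J] by auto
  have \<tau>: "\<tau> \<noteq> 0" using I0(3) by auto
  have merged: "s * \<alpha> I - t * \<beta> I = \<tau> * row_minor p (merge J j s t) I" if "card I = p" for s t I
    unfolding merge_minor[OF J j that] \<alpha>_def \<beta>_def by (simp add: algebra_simps)
  have prod: "0 \<le> (s * \<alpha> I - t * \<beta> I) * (s * \<alpha> I' - t * \<beta> I')"
    if st: "0 \<le> s" "0 \<le> t" and I: "I \<subseteq> {..<n}" "card I = p" "I' \<subseteq> {..<n}" "card I' = p" for s t I I'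
  proof -
    have "0 \<le> row_minor p (merge J j s t) I * row_minor p (merge J j s t) I'"
      by (rule minors_product_nonneg[OF merge_not_alternates[OF J j st] I])
    then have "0 \<le> \<tau>\<^sup>2 * (row_minor p (merge J j s t) I * row_minor p (merge J j s t) I')" by simp
    then show ?thesis unfolding merged[OF I(2)] merged[OF I(4)] by (simp add: power2_eq_square mult_ac)
  qed
  have \<alpha>0: "0 < \<alpha> I0" using I0(3) by (simp add: \<alpha>_def)
  have \<beta>_nonneg: "0 \<le> \<beta> I" if "I \<subseteq> {..<n}" "card I = p" for I
    using le[OF that] by (simp add: \<beta>_def)
  have \<alpha>_nonneg: "0 \<le> \<alpha> I" if "I \<subseteq> {..<n}" "card I = p" for I
    using prod[of 1 0 I0 I] that I0(1,2) \<alpha>0 by (simp add: zero_le_mult_iff)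
  have ratio: "\<alpha> I * \<beta> I' \<le> \<alpha> I' * \<beta> I"
    if I: "I \<subseteq> {..<n}" "card I = p" "I' \<subseteq> {..<n}" "card I' = p" for I I'
  proof (rule ccontr)
    assume "\<not> \<alpha> I * \<beta> I' \<le> \<alpha> I' * \<beta> I"
    then have gt: "0 < \<alpha> I * \<beta> I' - \<alpha> I' * \<beta> I" by simp
    (* With these weights the merged minors at I and at the other index set are opposite numbers. *)
    let ?s = "\<beta> I + \<beta> I'" and ?t = "\<alpha> I + \<alpha> I'"
    have "?s * \<alpha> I - ?t * \<beta> I = \<alpha> I * \<beta> I' - \<alpha> I' * \<beta> I"
      "?s * \<alpha> I' - ?t * \<beta> I' = - (\<alpha> I * \<beta> I' - \<alpha> I' * \<beta> I)"
      by (simp_all add: algebra_simps)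
    moreover have "0 \<le> ?s" "0 \<le> ?t" using I by (simp_all add: \<alpha>_nonneg \<beta>_nonneg)
    ultimately have "0 \<le> (\<alpha> I * \<beta> I' - \<alpha> I' * \<beta> I) * - (\<alpha> I * \<beta> I' - \<alpha> I' * \<beta> I)"
      using prod[of ?s ?t, OF _ _ I] by metis
    then have "0 \<le> - ((\<alpha> I * \<beta> I' - \<alpha> I' * \<beta> I) * (\<alpha> I * \<beta> I' - \<alpha> I' * \<beta> I))"
      by (simp only: mult_minus_right)
    then show False using mult_pos_pos[OF gt gt] by (simp only: neg_0_le_iff_le not_less[symmetric])
  qed
  have finJ': "finite ?J'" using finJ by simp
  obtain I1 where I1: "I1 \<subseteq> {..<n}" "card I1 = p" "row_minor p (columns X ?J') I1 \<noteq> 0"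
    by (rule indep_nonzero_minor[OF finJ' J'(2) indep[OF J']])
  have \<beta>1: "0 < \<beta> I1" using \<beta>_nonneg[OF I1(1,2)] I1(3) \<tau> by (auto simp: \<beta>_def less_le)
  have "0 < \<alpha> I0 * \<beta> I1" using \<alpha>0 \<beta>1 by (rule mult_pos_pos)
  also have "\<dots> \<le> \<alpha> I1 * \<beta> I0" by (rule ratio[OF I0(1,2) I1(1,2)])
  finally have \<beta>0: "0 < \<beta> I0"
    using \<beta>_nonneg[OF I0(1,2)] by (cases "\<beta> I0 = 0") auto
  have zero: "row_minor p (merge J j (\<beta> I0) (\<alpha> I0)) I = 0" if I: "I \<subseteq> {..<n}" "card I = p" for I
  proof -
    have "\<alpha> I * \<beta> I0 = \<alpha> I0 * \<beta> I"
      using ratio[OF I0(1,2) I] ratio[OF I I0(1,2)] by simp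
    then have "\<beta> I0 * \<alpha> I - \<alpha> I0 * \<beta> I = 0" by (simp add: mult.commute)
    then show ?thesis using merged[OF I(2)] \<tau> by simp
  qed
  show False
  proof (rule nonzero_minor_exists)
    fix y b assume ker: "\<And>i. i < n \<Longrightarrow> img p (merge J j (\<beta> I0) (\<alpha> I0)) y i = 0" and b: "b < p"
    show "y b = 0"
    proof (rule ccontr)
      assume "y b \<noteq> 0"
      then show False using singular_merge_impossible[OF J j \<beta>0 \<alpha>0 ker b] by blast
    qed
  next
    fix I assume "I \<subseteq> {..<n}" "card I = p" "row_minor p (merge J j (\<beta> I0) (\<alpha> I0)) I \<noteq> 0"
    then show False using zero by blast
  qed
qed

lemma cols_minors_product_nonneg:
  assumes p: "0 < p" and J: "J \<subseteq> {..<m}" "card J = p"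
    and I: "I \<subseteq> {..<n}" "card I = p" "I' \<subseteq> {..<n}" "card I' = p"
  shows "0 \<le> row_minor p (columns X J) I * row_minor p (columns X J) I'"
proof (rule minors_product_nonneg[OF _ I])
  fix y :: "nat \<Rightarrow> real"
  have finJ: "finite J" using J(1) finite_subset by blast
  have neJ: "J \<noteq> {}" using p J(2) by auto
  define u where "u e = (if e \<in> J then y (cell J e) else 0)" for e
  have "\<not> alternates p m u"
    by (rule not_alternates_cells[OF finJ J(2) neJ, of m u y]) (simp_all add: u_def)
  then have "\<not> alternates p n (\<lambda>i. \<Sum>e<m. X i e * u e)" by (rule bounding)
  moreover have "(\<Sum>e<m. X i e * u e) = img p (columns X J) y i" for i
  proof -
    have "(\<Sum>e<m. X i e * u e) = (\<Sum>e\<in>J. X i e * u e)"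
      using J(1) by (intro sum.mono_neutral_right) (auto simp: u_def)
    also have "\<dots> = img p (columns X J) y i"
      unfolding img_cols[OF finJ J(2)] by (intro sum.cong) (simp_all add: u_def cell_member[OF finJ])
    finally show ?thesis .
  qed
  ultimately show "\<not> alternates p n (img p (columns X J) y)" by simp
qed

text \<open>Whether some minor with the columns \<open>J\<close> is positive is invariant under moving one column to a free
  neighbouring place, hence the same for all \<open>J\<close>.\<close>

lemma minors_one_sign:
  assumes p: "0 < p"
  obtains \<tau> where "\<tau> = 1 \<or> \<tau> = -1"
    and "\<And>I J. I \<subseteq> {..<n} \<Longrightarrow> card I = p \<Longrightarrow> J \<subseteq> {..<m} \<Longrightarrow> card J = p \<Longrightarrow> 0 \<le> \<tau> * row_minor p (columns X J) I"
proof -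
  define P where "P J \<longleftrightarrow> (\<exists>I\<subseteq>{..<n}. card I = p \<and> 0 < row_minor p (columns X J) I)" for J
  have P_nonneg: "0 \<le> row_minor p (columns X J) I"
    if P: "P J" and J: "J \<subseteq> {..<m}" "card J = p" and I: "I \<subseteq> {..<n}" "card I = p" for J I
  proof -
    obtain I0 where I0: "I0 \<subseteq> {..<n}" "card I0 = p" "0 < row_minor p (columns X J) I0"
      using P unfolding P_def by blast
    show ?thesis using cols_minors_product_nonneg[OF p J I0(1,2) I] I0(3) by (simp add: zero_le_mult_iff)
  qed
  have step: "P J \<longleftrightarrow> P (insert (Suc j) (J - {j}))"
    if J: "J \<subseteq> {..<m}" "card J = p" and j: "j \<in> J" "Suc j < m" "Suc j \<notin> J" for J j
  proof -
    let ?J' = "insert (Suc j) (J - {j})"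
    have finJ: "finite J" using J(1) finite_subset by blast
    have J': "?J' \<subseteq> {..<m}" "card ?J' = p" using J j finJ card_gt_0_iff[of J] by auto
    show ?thesis
    proof
      assume "P J"
      then obtain I0 where I0: "I0 \<subseteq> {..<n}" "card I0 = p" "0 < 1 * row_minor p (columns X J) I0"
        unfolding P_def by auto
      show "P ?J'"
      proof (rule ccontr)
        assume neg: "\<not> P ?J'"
        show False
        proof (rule adjacent_columns_sign[OF J j I0])
          show "1 * row_minor p (columns X ?J') I \<le> 0" if "I \<subseteq> {..<n}" "card I = p" for I
            using neg that unfolding P_def by (metis mult_1 not_le)
        qed
      qed
    next
      assume P': "P ?J'"
      show "P J"
      proof (rule ccontr)
        assume neg: "\<not> P J"
        obtain I0 where I0: "I0 \<subseteq> {..<n}" "card I0 = p" "row_minor p (columns X J) I0 \<noteq> 0"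
          by (rule indep_nonzero_minor[OF finJ J(2) indep[OF J]])
        then have pos: "0 < -1 * row_minor p (columns X J) I0"
          using neg unfolding P_def by (metis linorder_neqE_linordered_idom mult_minus1 neg_0_less_iff_less)
        show False
        proof (rule adjacent_columns_sign[OF J j I0(1,2) pos])
          show "-1 * row_minor p (columns X ?J') I \<le> 0" if "I \<subseteq> {..<n}" "card I = p" for I
            using P_nonneg[OF P' J' that] by simp
        qed
      qed
    qed
  qed
  show ?thesis
  proof (cases "\<exists>J\<subseteq>{..<m}. card J = p \<and> P J")
    case True
    then obtain J0 where J0: "J0 \<subseteq> {..<m}" "card J0 = p" "P J0" by blast
    have all: "P J" if "J \<subseteq> {..<m}" "card J = p" for J
    proof (rule shift_connected[where P = P and J = J0])
      show "P J \<longleftrightarrow> P (insert (Suc j) (J - {j}))"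
        if "J \<subseteq> {..<m}" "card J = p" "j \<in> J" "Suc j < m" "Suc j \<notin> J" for J j
        by (rule step[OF that])
    qed (use J0 that in auto)
    show ?thesis
    proof (rule that)
      show "0 \<le> 1 * row_minor p (columns X J) I"
        if "I \<subseteq> {..<n}" "card I = p" "J \<subseteq> {..<m}" "card J = p" for I J
        using P_nonneg[OF all[OF that(3,4)] that(3,4) that(1,2)] by simp
    qed simp
  next
    case False
    show ?thesis
    proof (rule that)
      show "0 \<le> -1 * row_minor p (columns X J) I"
        if "I \<subseteq> {..<n}" "card I = p" "J \<subseteq> {..<m}" "card J = p" for I J
      proof -
        have "\<not> P J" using False that by blast
        then have "\<not> 0 < row_minor p (columns X J) I" using that unfolding P_def by blast
        then show ?thesis by simp
      qed
    qed simp
  qed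
qed

end

section \<open>From functions to matrices\<close>

lemma mult_mat_vec_sum:
  assumes "X \<in> carrier_mat n m" "u \<in> carrier_vec m" "i < n"
  shows "(X *\<^sub>v u) $ i = (\<Sum>e<m. X $$ (i, e) * u $ e)"
  using assms by (auto simp: scalar_prod_def atLeast0LessThan intro!: sum.cong)

lemma det_submatrix_eq:
  assumes X: "X \<in> carrier_mat n m" and I: "I \<subseteq> {..<n}" "card I = p" and J: "J \<subseteq> {..<m}" "card J = p"
  shows "det (submatrix X I J) = row_minor p (columns (\<lambda>i e. X $$ (i, e)) J) I"
proof -
  have "{i. i < n \<and> i \<in> I} = I" "{e. e < m \<and> e \<in> J} = J" using I J by auto
  then show ?thesis using X I J by (simp add: submatrix_def row_minor_def columns_def)
qed

lemma sign_consistent_iff: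
  assumes X: "X \<in> carrier_mat n m"
  shows "sign_consistent p X \<longleftrightarrow> (\<exists>\<tau>. (\<tau> = 1 \<or> \<tau> = -1) \<and>
    (\<forall>I J. I \<subseteq> {..<n} \<longrightarrow> card I = p \<longrightarrow> J \<subseteq> {..<m} \<longrightarrow> card J = p \<longrightarrow>
      0 \<le> \<tau> * row_minor p (columns (\<lambda>i e. X $$ (i, e)) J) I))"
proof -
  have dims: "dim_row X = n" "dim_col X = m" using X by auto
  let ?D = "\<lambda>I J. row_minor p (columns (\<lambda>i e. X $$ (i, e)) J) I"
  let ?C = "\<lambda>I J. I \<subseteq> {..<n} \<and> J \<subseteq> {..<m} \<and> card I = p \<and> card J = p"
  have sgn: "(?C I J \<longrightarrow> 0 \<le> det (submatrix X I J)) = (?C I J \<longrightarrow> 0 \<le> ?D I J)"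
    "(?C I J \<longrightarrow> det (submatrix X I J) \<le> 0) = (?C I J \<longrightarrow> ?D I J \<le> 0)" for I J
    using det_submatrix_eq[OF X] by simp_all
  have "sign_consistent p X \<longleftrightarrow>
    (\<forall>I J. I \<subseteq> {..<n} \<longrightarrow> card I = p \<longrightarrow> J \<subseteq> {..<m} \<longrightarrow> card J = p \<longrightarrow> 0 \<le> ?D I J) \<or>
    (\<forall>I J. I \<subseteq> {..<n} \<longrightarrow> card I = p \<longrightarrow> J \<subseteq> {..<m} \<longrightarrow> card J = p \<longrightarrow> ?D I J \<le> 0)"
    unfolding sign_consistent_def dims sgn by blast
  also have "\<dots> \<longleftrightarrow> (\<exists>\<tau>. (\<tau> = 1 \<or> \<tau> = -1) \<and>
    (\<forall>I J. I \<subseteq> {..<n} \<longrightarrow> card I = p \<longrightarrow> J \<subseteq> {..<m} \<longrightarrow> card J = p \<longrightarrow> 0 \<le> \<tau> * ?D I J))"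
    by (simp add: ex_disj_distrib conj_disj_distribR)
  finally show ?thesis .
qed

lemma variation_boundingD:
  assumes X: "X \<in> carrier_mat n m" and vb: "variation_bounding j X" and u: "\<not> alternates (Suc j) m u"
  shows "\<not> alternates (Suc j) n (\<lambda>i. \<Sum>e<m. X $$ (i, e) * u e)"
proof -
  let ?u = "vec m u"
  have u': "?u \<in> carrier_vec m" by simp
  have Xu: "X *\<^sub>v ?u \<in> carrier_vec n" using X by simp
  have "\<not> alternates (Suc j) m (($) ?u)"
    using u alternates_cong[of m "($) ?u" u "Suc j"] by simp
  then have Su: "S_minus ?u \<le> int j" unfolding alternates_iff_S_minus[OF u'] by simp
  have "S_minus (X *\<^sub>v ?u) \<le> int j"
  proof (cases "?u = 0\<^sub>v m")
    case True
    have "X *\<^sub>v ?u = 0\<^sub>v n" unfolding True using X by (intro eq_vecI) auto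
    then show ?thesis by (simp add: S_minus_def)
  next
    case False
    then show ?thesis using vb X Su u' unfolding variation_bounding_def by auto
  qed
  then have "\<not> alternates (Suc j) n (($) (X *\<^sub>v ?u))" unfolding alternates_iff_S_minus[OF Xu] by simp
  moreover have "(X *\<^sub>v ?u) $ i = (\<Sum>e<m. X $$ (i, e) * u e)" if "i < n" for i
    unfolding mult_mat_vec_sum[OF X u' that] by (intro sum.cong) auto
  ultimately show ?thesis
    using alternates_cong[of n "($) (X *\<^sub>v ?u)" "\<lambda>i. \<Sum>e<m. X $$ (i, e) * u e" "Suc j"] by blast
qed

lemma lin_indpt_cols_indep:
  assumes X: "X \<in> carrier_mat n m" and J: "J \<subseteq> {..<m}" and li: "lin_indpt_cols X J"
  shows "indep n (\<lambda>i e. X $$ (i, e)) J"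
  unfolding indep_def
proof (intro allI impI ballI)
  fix v e assume v: "\<forall>i<n. (\<Sum>e\<in>J. X $$ (i, e) * v e) = 0" and e: "e \<in> J"
  interpret vec_space "TYPE(real)" n .
  have inj: "inj_on (col X) J" and nd: "\<not> lin_dep (col X ` J)"
    using li X by (auto simp: lin_indpt_cols_def)
  have finJ: "finite J" using J finite_subset by blast
  have sub: "col X ` J \<subseteq> carrier_vec n" using X J by auto
  define a where "a x = v (the_inv_into J (col X) x)" for x
  have a: "a (col X e) = v e" if "e \<in> J" for e
    using the_inv_into_f_f[OF inj that] by (simp add: a_def)
  have "lincomb a (col X ` J) = 0\<^sub>v n"
  proof (rule eq_vecI)
    show "dim_vec (lincomb a (col X ` J)) = dim_vec (0\<^sub>v n :: real vec)"
      using lincomb_dim[OF finite_imageI[OF finJ] sub] by simp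
    fix i assume "i < dim_vec (0\<^sub>v n :: real vec)"
    then have i: "i < n" by simp
    have "lincomb a (col X ` J) $ i = (\<Sum>x\<in>col X ` J. a x * x $ i)" by (rule lincomb_index[OF i sub])
    also have "\<dots> = (\<Sum>e\<in>J. a (col X e) * col X e $ i)" by (rule sum.reindex[OF inj, unfolded o_def])
    also have "\<dots> = (\<Sum>e\<in>J. X $$ (i, e) * v e)"
      using X J i by (intro sum.cong) (auto simp: a)
    finally show "lincomb a (col X ` J) $ i = 0\<^sub>v n $ i" using v i by simp
  qed
  then have "a (col X e) = 0"
    using nd lin_dep_crit[OF finite_imageI[OF finJ] subset_refl, where a = a and v = "col X e"] e by auto
  then show "v e = 0" using a[OF e] by simp
qed

lemma lin_indpt_cols_subset:
  assumes "lin_indpt_cols X K" "J \<subseteq> K"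
  shows "lin_indpt_cols X J"
proof -
  interpret vec_space "TYPE(real)" "dim_row X" .
  show ?thesis
    using assms subset_li_is_li[of "col X ` K" "col X ` J"] inj_on_subset
    unfolding lin_indpt_cols_def by (metis image_mono)
qed

text \<open>Otherwise the columns in \<open>J\<close> would be a maximal independent set of columns, whose size is the rank.\<close>

lemma lin_indpt_cols_extend:
  assumes X: "X \<in> carrier_mat n m" and J: "J \<subseteq> {..<m}" and li: "lin_indpt_cols X J"
    and rank: "card J < vec_space.rank n X"
  shows "\<exists>l<m. l \<notin> J \<and> lin_indpt_cols X (insert l J)"
proof -
  interpret vec_space "TYPE(real)" n .
  have dims: "dim_row X = n" "dim_col X = m" using X by auto
  have inj: "inj_on (col X) J" and nd: "\<not> lin_dep (col X ` J)"
    using li X by (auto simp: lin_indpt_cols_def)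
  let ?P = "\<lambda>T. T \<subseteq> set (cols X) \<and> \<not> lin_dep T"
  have set_cols: "set (cols X) = col X ` {..<m}"
    using X by (auto simp: cols_def)
  have PJ: "?P (col X ` J)" using nd J set_cols by auto
  have "\<not> maximal (col X ` J) ?P"
    using rank_card_indpt[OF X, of "col X ` J"] rank card_image[OF inj] by auto
  then have "\<exists>T. col X ` J \<subseteq> T \<and> ?P T \<and> T \<noteq> col X ` J"
    using PJ unfolding maximal_def by (metis (no_types, lifting))
  then obtain T where T: "col X ` J \<subseteq> T" "T \<subseteq> col X ` {..<m}" "\<not> lin_dep T" "T \<noteq> col X ` J"
    unfolding set_cols by (elim exE conjE)
  from T(1,4) obtain x where x: "x \<in> T" "x \<notin> col X ` J" by (metis subsetI subset_antisym)
  then have "x \<in> col X ` {..<m}" using T(2) by (metis subsetD)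
  then obtain l where l: "l < m" "col X l = x" by (metis imageE lessThan_iff)
  have "col X ` insert l J \<subseteq> T" using T(1) x(1) l(2) by simp
  then have "\<not> lin_dep (col X ` insert l J)" using subset_li_is_li[OF T(3)] by simp
  moreover have "l \<notin> J" using x(2) l(2) by auto
  moreover from this have "inj_on (col X) (insert l J)" using inj x(2) l(2) by simp
  ultimately have "lin_indpt_cols X (insert l J)" unfolding lin_indpt_cols_def dims by simp
  then show ?thesis using l(1) \<open>l \<notin> J\<close> by (intro exI[of _ l]) simp
qed

theorem corollary5:
  fixes X :: "real mat" and n m k :: nat
  assumes "X \<in> carrier_mat n m"
    and "k \<ge> 1"
    and "vec_space.rank n X > k"
    and "\<And>J. J \<subseteq> {..<m} \<Longrightarrow> card J = k \<Longrightarrow> lin_indpt_cols X J"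
  shows "variation_diminishing (k - 1) X \<longleftrightarrow> sign_regular k X"
proof -
  note X = assms(1)
  let ?F = "\<lambda>i e. X $$ (i, e)"
  have "vec_space.rank n X \<le> m" using X by (rule vec_space.rank_le_nc)
  then have km: "k < m" using assms(3) by simp
  have li: "lin_indpt_cols X J" if J: "J \<subseteq> {..<m}" "card J = p" and p: "p \<le> k" for p J
  proof -
    have "finite J" using J(1) finite_subset by blast
    then obtain K where "J \<subseteq> K" "K \<subseteq> {..<m}" "card K = k"
      using exists_subset_between[of J k "{..<m}"] J p km by auto
    then show ?thesis using lin_indpt_cols_subset assms(4) by blast
  qed
  have ind: "indep n ?F J" if "J \<subseteq> {..<m}" "card J = p" "p \<le> k" for p J
    using lin_indpt_cols_indep[OF X that(1) li[OF that]] .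
  show ?thesis
  proof
    assume vd: "variation_diminishing (k - 1) X"
    show "sign_regular k X"
      unfolding sign_regular_def
    proof
      fix p assume p: "p \<in> {1..k}"
      then have p0: "0 < p" "p \<le> k" "Suc (p - 1) = p" by auto
      have vb: "variation_bounding (p - 1) X"
        using vd p unfolding variation_diminishing_def by auto
      interpret bounding n m p ?F
      proof
        show "\<not> alternates p n (\<lambda>i. \<Sum>e<m. X $$ (i, e) * u e)" if "\<not> alternates p m u" for u
          using variation_boundingD[OF X vb, of u] that unfolding p0(3) by blast
        show "indep n ?F J" if "J \<subseteq> {..<m}" "card J = p" for J by (rule ind[OF that p0(2)])
        show "\<exists>l<m. l \<notin> J \<and> indep n ?F (insert l J)" if J: "J \<subseteq> {..<m}" "card J = p" for J
        proof -
          have "card J < vec_space.rank n X" using J(2) p0(2) assms(3) by simp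
          from lin_indpt_cols_extend[OF X J(1) li[OF J p0(2)] this]
          obtain l where l: "l < m" "l \<notin> J" "lin_indpt_cols X (insert l J)" by blast
          moreover have "insert l J \<subseteq> {..<m}" using l(1) J(1) by simp
          ultimately show ?thesis using lin_indpt_cols_indep[OF X] by blast
        qed
      qed
      obtain \<tau> where "\<tau> = 1 \<or> \<tau> = -1"
        "\<And>I J. I \<subseteq> {..<n} \<Longrightarrow> card I = p \<Longrightarrow> J \<subseteq> {..<m} \<Longrightarrow> card J = p \<Longrightarrow> 0 \<le> \<tau> * row_minor p (columns ?F J) I"
        using minors_one_sign[OF p0(1)] by blast
      then show "sign_consistent p X" unfolding sign_consistent_iff[OF X] by blast
    qed
  next
    assume sr: "sign_regular k X"
    show "variation_diminishing (k - 1) X"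
      unfolding variation_diminishing_def variation_bounding_def
    proof (intro ballI impI)
      fix j u assume j: "j \<in> {0..k - 1}" and "u \<in> carrier_vec (dim_col X) - {0\<^sub>v (dim_col X)}"
        and Su: "S_minus u \<le> int j"
      then have u: "u \<in> carrier_vec m" "u \<noteq> 0\<^sub>v m" using X by auto
      obtain q c \<sigma> where q: "S_minus u = int q" and "\<sigma> = 1 \<or> \<sigma> = -1"
        and mono: "\<And>e e'. e \<le> e' \<Longrightarrow> e' < m \<Longrightarrow> c e \<le> c e'"
        and le: "\<And>e. e < m \<Longrightarrow> c e \<le> q"
        and rep: "\<And>b. b \<le> q \<Longrightarrow> \<exists>e<m. c e = b \<and> u $ e \<noteq> 0"
        and sg: "\<And>e. e < m \<Longrightarrow> u $ e = \<bar>u $ e\<bar> * (\<sigma> * (-1) ^ c e)"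
        by (rule S_minus_blocks[OF u]) (rule that)
      (* Let q be the exact number of sign changes of u; minors of order q + 1 then bound the image by q, hence by j. *)
      have qk: "Suc q \<in> {1..k}" and qj: "q \<le> j" using q Su j assms(2) by auto
      obtain \<tau> where \<tau>: "\<tau> = 1 \<or> \<tau> = -1"
        and sgn: "\<And>I J. I \<subseteq> {..<n} \<Longrightarrow> card I = Suc q \<Longrightarrow> J \<subseteq> {..<m} \<Longrightarrow> card J = Suc q \<Longrightarrow>
          0 \<le> \<tau> * row_minor (Suc q) (columns ?F J) I"
        using sr qk unfolding sign_regular_def sign_consistent_iff[OF X] by blast
      have noalt: "\<not> alternates (Suc q) n (\<lambda>i. \<Sum>e<m. X $$ (i, e) * (\<bar>u $ e\<bar> * (\<sigma> * (-1) ^ c e)))"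
      proof (rule block_image_not_alternates[where \<tau> = \<tau> and w = "\<lambda>b. \<sigma> * (-1) ^ b"])
        show "0 \<le> \<tau> * row_minor (Suc q) (columns ?F J) I"
          if "I \<subseteq> {..<n}" "card I = Suc q" "J \<subseteq> {..<m}" "card J = Suc q" for I J by (rule sgn[OF that])
        show "\<exists>I\<subseteq>{..<n}. card I = Suc q \<and> \<tau> * row_minor (Suc q) (columns ?F J) I \<noteq> 0"
          if J: "J \<subseteq> {..<m}" "card J = Suc q" for J
        proof -
          have "finite J" "Suc q \<le> k" using J(1) finite_subset qk by auto
          then obtain I where "I \<subseteq> {..<n}" "card I = Suc q" "row_minor (Suc q) (columns ?F J) I \<noteq> 0"
            using indep_nonzero_minor[OF _ J(2) ind[OF J]] by blast
          then show ?thesis using \<tau> by (intro exI[of _ I]) auto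
        qed
        show "c e \<le> c e'" if "e \<le> e'" "e' < m" for e e' by (rule mono[OF that])
        show "c e < Suc q" if "e < m" for e using le[OF that] by simp
        show "\<exists>e<m. c e = b \<and> 0 < \<bar>u $ e\<bar>" if "b < Suc q" for b using rep[of b] that by auto
      qed simp
      have Xu: "(X *\<^sub>v u) $ i = (\<Sum>e<m. X $$ (i, e) * (\<bar>u $ e\<bar> * (\<sigma> * (-1) ^ c e)))" if "i < n" for i
        unfolding mult_mat_vec_sum[OF X u(1) that]
      proof (rule sum.cong[OF refl])
        fix e assume "e \<in> {..<m}"
        then have "e < m" by simp
        from arg_cong[OF sg[OF this], of "(*) (X $$ (i, e))"]
        show "X $$ (i, e) * u $ e = X $$ (i, e) * (\<bar>u $ e\<bar> * (\<sigma> * (-1) ^ c e))" .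
      qed
      have "alternates (Suc q) n (($) (X *\<^sub>v u)) \<longleftrightarrow>
          alternates (Suc q) n (\<lambda>i. \<Sum>e<m. X $$ (i, e) * (\<bar>u $ e\<bar> * (\<sigma> * (-1) ^ c e)))"
        by (rule alternates_cong) (rule Xu)
      moreover have "X *\<^sub>v u \<in> carrier_vec n" by (rule mult_mat_vec_carrier[OF X u(1)])
      ultimately have "S_minus (X *\<^sub>v u) \<le> int q"
        using alternates_iff_S_minus[of "X *\<^sub>v u" n "Suc q"] noalt by simp
      then show "S_minus (X *\<^sub>v u) \<le> int j" using qj by simp
    qed
  qed
qed

end
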